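(* Let $G$ be a finite simple graph on the vertex set $V=\{x_1,\dots,x_n\}$, and let $k$ be a field. Let $H$ be a graph whose vertex set is a subset $W\subseteq V$ and which is either the complete graph $K_m$ on $W$ (with $|W|=m$) or a complete bipartite graph $K_{r,s}$ on $W$ (with $r,s\ge 1$, $|W|=r+s$, and a fixed bipartition $W=X\sqcup Y$, $|X|=r$, $|Y|=s$). Then $G$ contains $H$ as a subgraph (that is, every edge of $H$ is an edge of $G$) if and only if $$\beta_{i,\alpha}(H)\le \beta_{i,\alpha}(G)\quad\text{for all } i\ge 0 \text{ and all } \alpha\in\mathbb{Z}^n.$$ Furthermore, if $H=K_m$ and these equivalent conditions hold, then $\beta_{i,\alpha}(H)=\beta_{i,\alpha}(G)$ for all $i\ge 0$ and all $\alpha\in\mathbb{Z}^n$ with $\operatorname{supp}(\alpha)\subseteq W$.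
   Context: Graphs are finite and simple (no loops, no multiple edges). Let $R=k[x_1,\dots,x_n]$, with its $\mathbb{Z}^n$-grading in which $\deg(x_i)=\mathbf{e}_i$ is the $i$th standard unit vector; the variables are identified with the vertices of $G$. The edge ideal of a graph $F$ whose vertex set is contained in $V$ is $I(F)=\langle xy : xy \text{ is an edge of } F\rangle\subseteq R$. For such $F$, $i\ge 0$ and $\alpha\in\mathbb{Z}^n$, $\beta_{i,\alpha}(F)$ denotes the $i$th multigraded Betti number of the ideal $I(F)$ (regarded as an $R$-module; not of $R/I(F)$) in degree $\alpha$: the minimal $\mathbb{Z}^n$-graded free resolution of $I(F)$ over $R$ has $\bigoplus_{\alpha}R(-\alpha)^{\beta_{i,\alpha}(F)}$ in homological degree $i$, so the $\beta_{0,\alpha}$ count minimal generators. For $\alpha=(\alpha_1,\dots,\alpha_n)\in\mathbb{Z}^n$, $\operatorname{supp}(\alpha)=\{x_i : \alpha_i\neq 0\}$. The complete bipartite graph with bipartition $W=X\sqcup Y$ has edge set $\{xy : x\in X,\ y\in Y\}$. *)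

theory Defs
  imports "HOL-Library.Poly_Mapping" "Jordan_Normal_Form.Matrix_Kernel"
begin

section \<open>Graphs\<close>

record 'v graph =
  verts :: "'v set"
  edges :: "'v set set"

definition simple_graph :: "'v graph \<Rightarrow> bool" where
  "simple_graph G \<longleftrightarrow>
     finite (verts G) \<and> edges G \<subseteq> {{x, y} | x y. x \<in> verts G \<and> y \<in> verts G \<and> x \<noteq> y}"

definition subgraph :: "'v graph \<Rightarrow> 'v graph \<Rightarrow> bool" where
  "subgraph H G \<longleftrightarrow> verts H \<subseteq> verts G \<and> edges H \<subseteq> edges G"

definition complete_graph :: "'v set \<Rightarrow> 'v graph" where
  "complete_graph W = \<lparr>verts = W, edges = {{x, y} | x y. x \<in> W \<and> y \<in> W \<and> x \<noteq> y}\<rparr>"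

text \<open>Meant for disjoint \<open>X\<close> and \<open>Y\<close>.\<close>

definition complete_bipartite_graph :: "'v set \<Rightarrow> 'v set \<Rightarrow> 'v graph" where
  "complete_bipartite_graph X Y = \<lparr>verts = X \<union> Y, edges = {{x, y} | x y. x \<in> X \<and> y \<in> Y}\<rparr>"

section \<open>The multigraded polynomial ring and edge ideals\<close>

text \<open>
  With \<open>'v\<close> finite, \<open>('v, 'k) mpoly\<close> is the polynomial ring over \<open>'k\<close> whose variables are the
  elements of \<open>'v\<close>; a monomial is given by its exponent vector. Elements of the grading group
  are functions \<open>'v \<Rightarrow> int\<close>.
\<close>

type_synonym ('v, 'k) mpoly = "('v \<Rightarrow>\<^sub>0 nat) \<Rightarrow>\<^sub>0 'k"

definition var :: "'v \<Rightarrow> ('v, 'k::field) mpoly" where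
  "var x = Poly_Mapping.single (Poly_Mapping.single x 1) 1"

definition ideal_generated :: "('v, 'k::field) mpoly set \<Rightarrow> ('v, 'k) mpoly set" where
  "ideal_generated B = Modules.module.span (*) B"

definition edge_ideal :: "'v graph \<Rightarrow> ('v, 'k::field) mpoly set" where
  "edge_ideal F = ideal_generated {var x * var y | x y. {x, y} \<in> edges F}"

text \<open>The zero polynomial is homogeneous of every degree; if some entry of \<open>\<delta>\<close> is negative,
  it is the only one that is homogeneous of degree \<open>\<delta>\<close>.\<close>

definition homogeneous :: "('v \<Rightarrow> int) \<Rightarrow> ('v, 'k::field) mpoly \<Rightarrow> bool" where
  "homogeneous \<delta> p \<longleftrightarrow>
     (\<forall>m \<in> Poly_Mapping.keys p. \<forall>x. int (Poly_Mapping.lookup m x) = \<delta> x)"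

section \<open>Minimal multigraded free resolutions and Betti numbers\<close>

text \<open>
  A list \<open>\<rho>\<close> of degrees stands for the graded free module \<open>\<Oplus>\<^sub>a R(-\<rho>\<^sub>a)\<close>, whose elements are
  the vectors over \<open>R\<close> of dimension \<open>length \<rho>\<close> and whose \<open>a\<close>-th basis vector has degree \<open>\<rho>\<^sub>a\<close>.
  A matrix \<open>A\<close> represents a degree-preserving map from the module of \<open>\<sigma>\<close> to that of \<open>\<rho>\<close> iff
  every entry \<open>A\<^sub>a\<^sub>b\<close> is homogeneous of degree \<open>\<sigma>\<^sub>b - \<rho>\<^sub>a\<close>.
\<close>

definition graded_map ::
  "('v \<Rightarrow> int) list \<Rightarrow> ('v \<Rightarrow> int) list \<Rightarrow> ('v, 'k::field) mpoly mat \<Rightarrow> bool" where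
  "graded_map \<sigma> \<rho> A \<longleftrightarrow>
     A \<in> carrier_mat (length \<rho>) (length \<sigma>) \<and>
     (\<forall>a < length \<rho>. \<forall>b < length \<sigma>. homogeneous (\<lambda>x. (\<sigma> ! b) x - (\<rho> ! a) x) (A $$ (a, b)))"

text \<open>
  The complex \<open>\<cdots> \<rightarrow> F 2 \<rightarrow> F 1 \<rightarrow> F 0 \<rightarrow> I \<rightarrow> 0\<close>, where \<open>d (Suc i)\<close> is the map
  \<open>F (Suc i) \<rightarrow> F i\<close> and \<open>d 0\<close> is the augmentation \<open>F 0 \<rightarrow> I\<close>, regarded as a map to
  \<open>R = R(0)\<close>. Minimality means that the maps \<open>d (Suc i)\<close> have all their entries in the maximal
  ideal generated by the variables. This resolves the ideal \<open>I\<close> itself, not the quotient by it.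
\<close>

definition minimal_free_resolution ::
  "('v, 'k::field) mpoly set \<Rightarrow> (nat \<Rightarrow> ('v \<Rightarrow> int) list) \<Rightarrow> (nat \<Rightarrow> ('v, 'k) mpoly mat) \<Rightarrow> bool"
where
  "minimal_free_resolution I F d \<longleftrightarrow>
     graded_map (F 0) [\<lambda>_. 0] (d 0) \<and>
     (\<forall>i. graded_map (F (Suc i)) (F i) (d (Suc i))) \<and>
     {(d 0 *\<^sub>v v) $ 0 | v. v \<in> carrier_vec (length (F 0))} = I \<and>
     (\<forall>i. mat_kernel (d i) = {d (Suc i) *\<^sub>v w | w. w \<in> carrier_vec (length (F (Suc i)))}) \<and>
     (\<forall>i. elements_mat (d (Suc i)) \<subseteq> ideal_generated (range var))"

text \<open>
  The minimal resolution exists and is unique up to isomorphism for every homogeneous ideal, so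
  the choice does not affect the Betti numbers; the first argument only fixes the field.
\<close>

definition minimal_resolution_degrees ::
  "('v, 'k::field) mpoly set \<Rightarrow> nat \<Rightarrow> ('v \<Rightarrow> int) list" where
  "minimal_resolution_degrees I = (SOME F. \<exists>d. minimal_free_resolution I F d)"

definition betti :: "'k::field itself \<Rightarrow> 'v graph \<Rightarrow> nat \<Rightarrow> ('v \<Rightarrow> int) \<Rightarrow> nat" where
  "betti _ F i \<alpha> = count_list (minimal_resolution_degrees (edge_ideal F :: ('v, 'k) mpoly set) i) \<alpha>"

definition supp :: "('v \<Rightarrow> int) \<Rightarrow> 'v set" where
  "supp \<alpha> = {x. \<alpha> x \<noteq> 0}"

end

(* A multigraded map between free modules is a matrix of scalars times monomials, so a multigraded
   resolution is exact over the polynomial ring iff all its strands, which are complexes of vector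
   spaces, are exact. Both kinds of H have a linear resolution. This is shown for an arbitrary
   minimal resolution by restricting the strand of degree alpha, one variable x at a time, to the
   generators whose x-exponent is that of alpha; once all variables are treated, only the minimal
   generators of degree alpha are left.
   On the linear strand an inclusion of edge ideals induces injections of the Betti spaces, because
   nothing of smaller total degree interferes; this gives the inequality, and it gives the equality
   for complete H because I(H) and I(G) agree in all degrees supported on W. Conversely, the edges of
   a graph are visible in its Betti numbers in homological degree 0.
   A minimal resolution exists since syzygies are generated in joins of the degrees of the
   generators, of which there are finitely many. *)
theory Submission
  imports Defs
begin

text \<open>The obstacle is that \<open>betti\<close> counts degrees in a resolution picked by
  choice. Nothing can be said about it before some minimal resolution is exhibited, and linearity
  has to hold for whichever one is picked; so it is derived from exactness and minimality rather
  than from an explicit complex for H. For a set U of variables, the generators of degree at most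
  \<alpha> that agree with \<alpha> on U form a basis of the degree \<alpha> part of F tensored with
  R/(x_u : u in U). Fixing more variables leads from the strand of R/I to Tor(R/I, k) in degree
  \<alpha>, and each new variable x is a Koszul step relating the degrees \<alpha> and \<alpha> -
  e_x. What enters about H is how membership in I(H) behaves when variables, above all the two
  endpoints of an edge, are divided out. The constant 2 is the degree of an edge monomial:
  differentials raise the total degree strictly, so homological degree i starts in total degree i +
  2. G need not have a linear resolution, hence the comparison is confined to this lowest
  diagonal.\<close>

section \<open>Strands of a multigraded complex\<close>

text \<open>The vector \<open>c\<close> stands for the element \<open>\<Sum>\<^sub>b c\<^sub>b x\<^bsup>\<alpha> - \<sigma>\<^sub>b\<^esup> e\<^sub>b\<close> of degree \<open>\<alpha>\<close> of the free module of \<open>\<sigma>\<close>.\<close>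

definition strand :: "('v \<Rightarrow> int) list \<Rightarrow> ('v \<Rightarrow> int) \<Rightarrow> (nat \<Rightarrow> 'k::field) set" where
  "strand \<sigma> \<alpha> = {c. \<forall>b. c b \<noteq> 0 \<longrightarrow> b < length \<sigma> \<and> \<sigma> ! b \<le> \<alpha>}"

definition mat_act :: "nat \<Rightarrow> (nat \<Rightarrow> nat \<Rightarrow> 'k::field) \<Rightarrow> (nat \<Rightarrow> 'k) \<Rightarrow> nat \<Rightarrow> 'k" where
  "mat_act n A c = (\<lambda>a. \<Sum>b<n. A a b * c b)"

definition std_unit :: "nat \<Rightarrow> nat \<Rightarrow> 'k::field" where
  "std_unit b = (\<lambda>a. if a = b then 1 else 0)"

definition total_degree :: "('v::finite \<Rightarrow> int) \<Rightarrow> int" where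
  "total_degree \<alpha> = (\<Sum>x\<in>UNIV. \<alpha> x)"

lemma strandD: "c \<in> strand \<sigma> \<alpha> \<Longrightarrow> c b \<noteq> 0 \<Longrightarrow> b < length \<sigma> \<and> \<sigma> ! b \<le> \<alpha>"
  by (auto simp: strand_def)

lemma strandI: "(\<And>b. c b \<noteq> 0 \<Longrightarrow> b < length \<sigma> \<and> \<sigma> ! b \<le> \<alpha>) \<Longrightarrow> c \<in> strand \<sigma> \<alpha>"
  by (auto simp: strand_def)

lemma strand_mono: "c \<in> strand \<sigma> \<alpha> \<Longrightarrow> \<alpha> \<le> \<beta> \<Longrightarrow> c \<in> strand \<sigma> \<beta>"
  unfolding strand_def by (blast intro: order_trans)

lemma strand_zero [simp]: "(\<lambda>_. 0) \<in> strand \<sigma> \<alpha>"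
  by (auto simp: strand_def)

lemma strand_diff: "c \<in> strand \<sigma> \<alpha> \<Longrightarrow> d \<in> strand \<sigma> \<alpha> \<Longrightarrow> (\<lambda>b. c b - d b) \<in> strand \<sigma> \<alpha>"
  unfolding strand_def by (auto, (metis diff_self)+)

lemma strand_scale: "c \<in> strand \<sigma> \<alpha> \<Longrightarrow> (\<lambda>b. r * c b) \<in> strand \<sigma> \<alpha>"
  by (auto simp: strand_def)

lemma std_unit_strand: "b < length \<sigma> \<Longrightarrow> \<sigma> ! b \<le> \<alpha> \<Longrightarrow> std_unit b \<in> strand \<sigma> \<alpha>"
  by (auto simp: strand_def std_unit_def)

lemma mat_act_diff: "mat_act n A (\<lambda>b. c b - d b) = (\<lambda>a. mat_act n A c a - mat_act n A d a)"
  by (simp add: mat_act_def algebra_simps sum_subtractf)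

lemma mat_act_scale: "mat_act n A (\<lambda>b. r * c b) = (\<lambda>a. r * mat_act n A c a)"
  by (simp add: mat_act_def sum_distrib_left algebra_simps)

lemma mat_act_sum: "mat_act n A (\<lambda>a. \<Sum>i\<in>I. c i a) = (\<lambda>a. \<Sum>i\<in>I. mat_act n A (c i) a)"
  unfolding mat_act_def sum_distrib_left by (intro ext) (rule sum.swap)

lemma mat_act_zero [simp]: "mat_act n A (\<lambda>_. 0) = (\<lambda>_. 0)"
  by (simp add: mat_act_def)

lemma mat_act_unit: "b < n \<Longrightarrow> mat_act n A (std_unit b) a = A a b"
  by (simp add: mat_act_def std_unit_def if_distrib cong: if_cong)

lemma mat_act_nonzero:
  assumes nz: "mat_act n A c a \<noteq> 0"
  shows "\<exists>b<n. A a b \<noteq> 0 \<and> c b \<noteq> 0"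
proof (rule ccontr)
  assume "\<not> ?thesis"
  then have "A a b * c b = 0" if "b < n" for b using that by auto
  then have "mat_act n A c a = 0" unfolding mat_act_def by (intro sum.neutral) simp
  with nz show False ..
qed

lemma total_degree_less:
  assumes "\<alpha> < \<beta>" shows "total_degree \<alpha> < total_degree \<beta>"
proof -
  have le: "\<alpha> x \<le> \<beta> x" for x using assms by (simp add: less_le_not_le[of \<alpha>] le_fun_def)
  moreover obtain x where "\<not> \<beta> x \<le> \<alpha> x" using assms by (auto simp: less_le_not_le[of \<alpha>] le_fun_def)
  ultimately show ?thesis
    unfolding total_degree_def by (intro sum_strict_mono_ex1) (auto simp: not_le)
qed

lemma total_degree_le_eq: "\<alpha> \<le> \<beta> \<Longrightarrow> total_degree \<beta> \<le> total_degree \<alpha> \<Longrightarrow> \<alpha> = \<beta>"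
  using total_degree_less[of \<alpha> \<beta>] by (meson leD order.not_eq_order_implies_strict)

lemma total_degree_upd: "total_degree (\<alpha>(x := \<alpha> x - 1)) = total_degree \<alpha> - 1"
proof -
  have "total_degree (\<alpha>(x := \<alpha> x - 1)) = (\<Sum>y\<in>UNIV. \<alpha> y - (if y = x then 1 else 0))"
    unfolding total_degree_def by (rule sum.cong) auto
  then show ?thesis by (simp add: total_degree_def sum_subtractf)
qed

lemma lower_le: "\<alpha>(x := \<alpha> x - 1) \<le> (\<alpha> :: 'v \<Rightarrow> int)"
  by (simp add: le_fun_def)

text \<open>Here \<open>P \<alpha>\<close> means that the monomial \<open>x\<^bsup>\<alpha>\<^esup>\<close> lies in the ideal. Indices are shifted by one:
  \<open>F 0\<close> is the ring itself and \<open>F (Suc i)\<close> is the \<open>i\<close>-th module of the resolution of the ideal.\<close>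

locale strand_resolution =
  fixes P :: "('v::finite \<Rightarrow> int) \<Rightarrow> bool"
    and F :: "nat \<Rightarrow> ('v \<Rightarrow> int) list"
    and L :: "nat \<Rightarrow> nat \<Rightarrow> nat \<Rightarrow> 'k::field"
  assumes F0: "F 0 = [\<lambda>_. 0]"
    and entry: "\<And>i a b. L i a b \<noteq> 0 \<Longrightarrow>
        a < length (F i) \<and> b < length (F (Suc i)) \<and> F i ! a < F (Suc i) ! b"
    and aug: "\<And>\<alpha>. P \<alpha> \<longleftrightarrow> (\<exists>e\<in>strand (F 1) \<alpha>. mat_act (length (F 1)) (L 0) e = std_unit 0)"
    and exact: "\<And>i c \<alpha>. c \<in> strand (F (Suc i)) \<alpha> \<Longrightarrow>
        mat_act (length (F (Suc i))) (L i) c = (\<lambda>_. 0) \<longleftrightarrow>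
        (\<exists>e\<in>strand (F (Suc (Suc i))) \<alpha>. mat_act (length (F (Suc (Suc i)))) (L (Suc i)) e = c)"
begin

definition bd :: "nat \<Rightarrow> (nat \<Rightarrow> 'k) \<Rightarrow> nat \<Rightarrow> 'k" where
  "bd i = mat_act (length (F (Suc i))) (L i)"

lemma bd_scale: "bd i (\<lambda>b. r * c b) a = r * bd i c a"
  by (simp add: bd_def mat_act_scale)

lemma bd_nonzero:
  assumes "bd i c a \<noteq> 0"
  obtains b where "b < length (F (Suc i))" "a < length (F i)" "c b \<noteq> 0" "F i ! a < F (Suc i) ! b"
  using mat_act_nonzero[OF assms[unfolded bd_def]] entry by blast

lemma bd_strand: "c \<in> strand (F (Suc i)) \<alpha> \<Longrightarrow> bd i c \<in> strand (F i) \<alpha>"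
proof (rule strandI)
  fix a assume c: "c \<in> strand (F (Suc i)) \<alpha>" and "bd i c a \<noteq> 0"
  from this(2) obtain b where b: "a < length (F i)" "c b \<noteq> 0" "F i ! a < F (Suc i) ! b"
    by (rule bd_nonzero)
  from strandD[OF c b(2)] less_imp_le[OF b(3)] b(1) show "a < length (F i) \<and> F i ! a \<le> \<alpha>"
    by (auto intro: order_trans)
qed

text \<open>Minimality sits in the strict inequality of \<open>entry\<close>: a generator reached by
  the differential has degree strictly below one that is at most \<alpha>, so its own degree is not
  \<alpha>.\<close>

lemma bd_matching:
  assumes "c \<in> strand (F (Suc i)) \<alpha>" "F i ! a = \<alpha>"
  shows "bd i c a = 0"
proof (rule ccontr)
  assume "bd i c a \<noteq> 0"
  then obtain b where b: "c b \<noteq> 0" "F i ! a < F (Suc i) ! b" by (rule bd_nonzero)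
  from strandD[OF assms(1) b(1)] b(2) assms(2) show False by auto
qed

lemma bd_bd: "c \<in> strand (F (Suc (Suc i))) \<alpha> \<Longrightarrow> bd i (bd (Suc i) c) = (\<lambda>_. 0)"
  using exact[OF bd_strand, of c i \<alpha>] unfolding bd_def by blast

lemma kernel_lift:
  assumes "c \<in> strand (F (Suc i)) \<alpha>" "bd i c = (\<lambda>_. 0)"
  obtains e where "e \<in> strand (F (Suc (Suc i))) \<alpha>" "bd (Suc i) e = c"
  using exact[OF assms(1)] assms(2) unfolding bd_def by blast

text \<open>Cycles are boundaries, and boundaries of degree \<alpha> avoid the generators of degree
  \<alpha>. In module terms, the kernel lies in the maximal ideal times the free module.\<close>

lemma kernel_minimal:
  assumes "c \<in> strand (F (Suc i)) \<alpha>" "bd i c = (\<lambda>_. 0)" "b < length (F (Suc i))" "F (Suc i) ! b = \<alpha>"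
  shows "c b = 0"
proof -
  obtain e where e: "e \<in> strand (F (Suc (Suc i))) \<alpha>" "bd (Suc i) e = c"
    using kernel_lift[OF assms(1,2)] .
  then show ?thesis using bd_matching[OF e(1) assms(4)] by simp
qed

text \<open>Otherwise the basis vector would be a cycle with coefficient 1 in its own degree.
  Inductions over generators descend along this nonzero differential.\<close>

lemma bd_unit_nonzero:
  assumes "b < length (F (Suc i))"
  shows "bd i (std_unit b) \<noteq> (\<lambda>_. 0)"
  using kernel_minimal[OF std_unit_strand[OF assms order_refl] _ assms refl]
  by (auto simp: std_unit_def)

text \<open>Since \<open>F 0\<close> has rank one, a nonzero value of the augmentation is a multiple
  of \<open>std_unit 0\<close>, and dividing by the scalar gives the preimage that
  \<open>aug\<close> asks for.\<close>

lemma aug_scale: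
  assumes "e \<in> strand (F 1) \<alpha>" "bd 0 e \<noteq> (\<lambda>_. 0)"
  shows "P \<alpha>"
proof -
  have *: "bd 0 e \<in> strand (F 0) \<alpha>" using bd_strand[of e 0] assms(1) by simp
  have z: "bd 0 e a = 0" if "a \<noteq> 0" for a
    using strandD[OF *, of a] F0 that by auto
  have nz: "bd 0 e 0 \<noteq> 0"
  proof
    assume "bd 0 e 0 = 0"
    then have "bd 0 e a = 0" for a using z[of a] by (cases "a = 0") auto
    with assms(2) show False by blast
  qed
  have "bd 0 (\<lambda>b. inverse (bd 0 e 0) * e b) = std_unit 0"
    using z nz by (intro ext) (simp add: bd_scale std_unit_def)
  then show ?thesis
    unfolding aug using strand_scale[OF assms(1)] by (auto simp: bd_def)
qed

lemma aug_lift: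
  assumes "P \<alpha>" "c \<in> strand (F 0) \<alpha>"
  obtains e where "e \<in> strand (F 1) \<alpha>" "bd 0 e = c"
proof -
  obtain e where e: "e \<in> strand (F 1) \<alpha>" "bd 0 e = std_unit 0"
    using assms(1) aug unfolding bd_def by auto
  have "c a = 0" if "a \<noteq> 0" for a using strandD[OF assms(2), of a] F0 that by auto
  then have "bd 0 (\<lambda>b. c 0 * e b) = c"
    by (intro ext) (simp add: bd_scale e(2) std_unit_def)
  then show thesis using that strand_scale[OF e(1)] by blast
qed

text \<open>The differential of a generator is nonzero and involves only generators of smaller
  degree. Descending thus ends at a generator of the ideal of degree at most \<alpha>, which would
  put x^\<alpha> into the ideal.\<close>

lemma no_generators:
  assumes "\<not> P \<alpha>" "b < length (F (Suc i))"
  shows "\<not> F (Suc i) ! b \<le> \<alpha>"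
  using assms(2)
proof (induction i arbitrary: b)
  case 0
  then show ?case
    using aug_scale[OF std_unit_strand bd_unit_nonzero[of b 0]] assms(1) by auto
next
  case (Suc i)
  obtain a where "bd (Suc i) (std_unit b) a \<noteq> 0" using bd_unit_nonzero[OF Suc.prems] by auto
  then show ?case
    using Suc.IH strandD[OF bd_strand[OF std_unit_strand[OF Suc.prems]]] by blast
qed

lemma generator_P: "b < length (F (Suc i)) \<Longrightarrow> P (F (Suc i) ! b)"
  using no_generators by blast

text \<open>Generators of the ideal have total degree at least 2, and each further homological
  degree adds at least 1 because no nonzero entry of a differential is constant.\<close>

lemma generator_total_degree:
  assumes "\<And>\<alpha>. P \<alpha> \<Longrightarrow> 2 \<le> total_degree \<alpha>" "b < length (F (Suc i))"
  shows "int i + 2 \<le> total_degree (F (Suc i) ! b)"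
  using assms(2)
proof (induction i arbitrary: b)
  case 0
  then show ?case using assms(1) generator_P by auto
next
  case (Suc i)
  obtain a where "bd (Suc i) (std_unit b) a \<noteq> 0" using bd_unit_nonzero[OF Suc.prems] by auto
  then obtain b' where b': "a < length (F (Suc i))" "std_unit b b' \<noteq> (0::'k)" "F (Suc i) ! a < F (Suc (Suc i)) ! b'"
    by (rule bd_nonzero)
  then have "b' = b" by (auto simp: std_unit_def split: if_splits)
  with b' show ?case using Suc.IH[OF b'(1)] total_degree_less by fastforce
qed

section \<open>Subquotients of a strand obtained by fixing exponents\<close>

definition matches :: "'v set \<Rightarrow> ('v \<Rightarrow> int) \<Rightarrow> nat \<Rightarrow> nat \<Rightarrow> bool" where
  "matches U \<alpha> i a \<longleftrightarrow> a < length (F i) \<and> (\<forall>u\<in>U. (F i ! a) u = \<alpha> u)"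

definition bd_prev :: "nat \<Rightarrow> (nat \<Rightarrow> 'k) \<Rightarrow> nat \<Rightarrow> 'k" where
  "bd_prev i = (case i of 0 \<Rightarrow> (\<lambda>_ _. 0) | Suc j \<Rightarrow> bd j)"

text \<open>Exactness at position i of the quotient spanned by the matching generators. The entries
  of c elsewhere are free: a non-matching generator of degree at most \<alpha> has some exponent in
  U below that of \<alpha>, so nothing under it matches either. At i = 0 the condition on c is empty
  and exactness means surjectivity.\<close>

definition exact_at :: "'v set \<Rightarrow> ('v \<Rightarrow> int) \<Rightarrow> nat \<Rightarrow> bool" where
  "exact_at U \<alpha> i \<longleftrightarrow> (\<forall>c\<in>strand (F i) \<alpha>. (\<forall>a. matches U \<alpha> (i - 1) a \<longrightarrow> bd_prev i c a = 0) \<longrightarrow>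
     (\<exists>e\<in>strand (F (Suc i)) \<alpha>. \<forall>a. matches U \<alpha> i a \<longrightarrow> bd i e a = c a))"

lemma exact_atI:
  assumes "\<And>c. c \<in> strand (F i) \<alpha> \<Longrightarrow> (\<And>a. matches U \<alpha> (i - 1) a \<Longrightarrow> bd_prev i c a = 0) \<Longrightarrow>
    \<exists>e. e \<in> strand (F (Suc i)) \<alpha> \<and> (\<forall>a. matches U \<alpha> i a \<longrightarrow> bd i e a = c a)"
  shows "exact_at U \<alpha> i"
  using assms unfolding exact_at_def Bex_def by blast

lemma exact_atE:
  assumes "exact_at U \<alpha> i" "c \<in> strand (F i) \<alpha>" "\<And>a. matches U \<alpha> (i - 1) a \<Longrightarrow> bd_prev i c a = 0"
  obtains e where "e \<in> strand (F (Suc i)) \<alpha>" "\<And>a. matches U \<alpha> i a \<Longrightarrow> bd i e a = c a"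
  using assms unfolding exact_at_def by blast

text \<open>With no variable fixed the complex is the whole strand, which resolves the degree
  \<alpha> part of R/I. Homology can only sit at position 0, and it vanishes there when x^\<alpha>
  is in I.\<close>

lemma exact_at_empty:
  assumes P: "P \<alpha> \<or> 0 < i"
  shows "exact_at {} \<alpha> i"
proof (rule exact_atI)
  fix c :: "nat \<Rightarrow> 'k"
  assume c: "c \<in> strand (F i) \<alpha>" and van: "\<And>a. matches {} \<alpha> (i - 1) a \<Longrightarrow> bd_prev i c a = 0"
  obtain e where "e \<in> strand (F (Suc i)) \<alpha>" "bd i e = c"
  proof (cases i)
    case 0
    then have "P \<alpha>" "c \<in> strand (F 0) \<alpha>" using P c by auto
    then obtain e where "e \<in> strand (F 1) \<alpha>" "bd 0 e = c" by (rule aug_lift)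
    then show thesis using that 0 by simp
  next
    case (Suc j)
    have c': "c \<in> strand (F (Suc j)) \<alpha>" using c Suc by simp
    have "bd j c = (\<lambda>_. 0)"
    proof
      fix a
      show "bd j c a = 0"
      proof (cases "a < length (F j)")
        case True
        then show ?thesis using van[of a] by (simp add: matches_def bd_prev_def Suc)
      next
        case False
        then show ?thesis using strandD[OF bd_strand[OF c'], of a] by auto
      qed
    qed
    with c' obtain e where "e \<in> strand (F (Suc (Suc j))) \<alpha>" "bd (Suc j) e = c"
      by (rule kernel_lift)
    then show thesis using that Suc by simp
  qed
  then show "\<exists>e. e \<in> strand (F (Suc i)) \<alpha> \<and> (\<forall>a. matches {} \<alpha> i a \<longrightarrow> bd i e a = c a)"
    by (intro exI[of _ e]) simp
qed

text \<open>Nothing matches: at positive positions no generator has degree at most \<alpha>, and the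
  generator of position 0 has degree 0, which differs from \<alpha> at u. The quotient complex is
  zero.\<close>

lemma exact_at_no_generators:
  assumes "\<not> P \<alpha>" "u \<in> U" "\<alpha> u \<noteq> 0"
  shows "exact_at U \<alpha> i"
proof (rule exact_atI)
  fix c :: "nat \<Rightarrow> 'k"
  assume c: "c \<in> strand (F i) \<alpha>"
  have "c a = 0" if m: "matches U \<alpha> i a" for a
  proof (cases i)
    case 0
    then show ?thesis using m assms(2,3) F0 by (auto simp: matches_def)
  next
    case (Suc j)
    then show ?thesis
      using no_generators[OF assms(1), of a j] strandD[OF c, of a] by (cases "c a = 0") auto
  qed
  then show "\<exists>e. e \<in> strand (F (Suc i)) \<alpha> \<and> (\<forall>a. matches U \<alpha> i a \<longrightarrow> bd i e a = c a)"
    by (intro exI[of _ "\<lambda>_. 0"]) (simp add: bd_def)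
qed

text \<open>The sets of generators of degree at most \<open>\<alpha>\<close> that agree with \<open>\<alpha>\<close> on \<open>U\<close> span subquotient
  complexes of the strand, and this is one step of the long exact sequence of
  \<open>0 \<rightarrow> F[U, \<alpha> - e\<^sub>x] \<rightarrow> F[U, \<alpha>] \<rightarrow> F[U \<union> {x}, \<alpha>] \<rightarrow> 0\<close>.\<close>

lemma exact_at_insert:
  assumes x: "x \<notin> U" and ex: "exact_at U \<alpha> i" and ex': "0 < i \<Longrightarrow> exact_at U (\<alpha>(x := \<alpha> x - 1)) (i - 1)"
  shows "exact_at (insert x U) \<alpha> i"
proof (rule exact_atI)
  fix c :: "nat \<Rightarrow> 'k"
  assume c: "c \<in> strand (F i) \<alpha>"
    and van: "\<And>a. matches (insert x U) \<alpha> (i - 1) a \<Longrightarrow> bd_prev i c a = 0"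
  let ?\<beta> = "\<alpha>(x := \<alpha> x - 1)"
  have le: "?\<beta> \<le> \<alpha>" by (auto simp: le_fun_def)
  have m: "matches U ?\<beta> j a \<longleftrightarrow> matches U \<alpha> j a" for j a
    using x by (auto simp: matches_def)
  obtain b where b: "b \<in> strand (F i) ?\<beta>" "\<And>a. matches U \<alpha> (i - 1) a \<Longrightarrow> bd_prev i b a = bd_prev i c a"
  proof (cases i)
    case 0
    then show thesis using that[of "\<lambda>_. 0"] by (simp add: bd_prev_def)
  next
    case (Suc j)
    \<comment> \<open>This is the connecting map. As c is a cycle for \<open>insert x U\<close>, the
      part of its boundary that matches on U uses only generators with x-exponent below that of
      \<alpha>, so it lives in degree \<alpha> - e_x.\<close>
    define y where "y a = (if matches U \<alpha> j a then bd j c a else 0)" for a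
    have bc: "bd j c \<in> strand (F j) \<alpha>" using c Suc bd_strand by simp
    have y: "y \<in> strand (F j) ?\<beta>"
    proof (rule strandI)
      fix a assume "y a \<noteq> 0"
      then have a: "matches U \<alpha> j a" "bd j c a \<noteq> 0" by (auto simp: y_def split: if_splits)
      then have l: "a < length (F j)" "F j ! a \<le> \<alpha>" using strandD[OF bc] by auto
      have "\<not> matches (insert x U) \<alpha> j a" using van[of a] a Suc by (auto simp: bd_prev_def)
      with a have "(F j ! a) x \<noteq> \<alpha> x" by (auto simp: matches_def)
      with l have "(F j ! a) x \<le> \<alpha> x - 1" by (auto simp: le_fun_def dest!: spec[of _ x])
      with l show "a < length (F j) \<and> F j ! a \<le> ?\<beta>" by (auto simp: le_fun_def)
    qed
    have y0: "bd_prev j y a = 0" if a: "matches U \<alpha> (j - 1) a" for a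
    proof (cases j)
      case 0 then show ?thesis by (simp add: bd_prev_def)
    next
      case j: (Suc k)
      \<comment> \<open>What y omits from the boundary of c sits at generators not matching on U,
        and nothing below those matches. So y inherits the cycle condition.\<close>
      have z: "bd k (\<lambda>b. bd j c b - y b) a = 0"
      proof (rule ccontr)
        assume "bd k (\<lambda>b. bd j c b - y b) a \<noteq> 0"
        then obtain b where b: "b < length (F j)" "bd j c b - y b \<noteq> 0" "F k ! a < F j ! b"
          using j by (elim bd_nonzero) auto
        then have "\<not> matches U \<alpha> j b" "bd j c b \<noteq> 0" by (auto simp: y_def split: if_splits)
        with b(1) obtain u where u: "u \<in> U" "(F j ! b) u \<noteq> \<alpha> u" by (auto simp: matches_def)
        have "(F j ! b) u \<le> \<alpha> u" using strandD[OF bc \<open>bd j c b \<noteq> 0\<close>] by (auto simp: le_fun_def)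
        moreover have "(F k ! a) u \<le> (F j ! b) u" using less_imp_le[OF b(3)] by (simp add: le_fun_def)
        moreover have "(F k ! a) u = \<alpha> u" using a u(1) j by (auto simp: matches_def)
        ultimately show False using u(2) by simp
      qed
      have "bd k (bd j c) = (\<lambda>_. 0)" using bd_bd[of c k \<alpha>] c Suc j by simp
      with z show ?thesis by (simp add: bd_prev_def j bd_def mat_act_diff)
    qed
    have "exact_at U ?\<beta> j" using ex' Suc by simp
    then obtain b where "b \<in> strand (F (Suc j)) ?\<beta>" "\<And>a. matches U ?\<beta> j a \<Longrightarrow> bd j b a = y a"
      by (rule exact_atE[OF _ y]) (simp_all add: m y0)
    then show thesis using that[of b] by (simp add: m Suc bd_prev_def y_def)
  qed
  \<comment> \<open>Subtracting b, whose boundary agrees with that of c on U, makes c a cycle for U.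
    As b has degree \<alpha> - e_x, it is invisible at generators whose x-exponent is that of
    \<alpha>.\<close>
  have cb: "(\<lambda>a. c a - b a) \<in> strand (F i) \<alpha>" using c b(1) le by (auto intro: strand_diff strand_mono)
  have "bd_prev i (\<lambda>a. c a - b a) a = 0" if "matches U \<alpha> (i - 1) a" for a
    using b(2)[OF that] by (cases i) (auto simp: bd_prev_def bd_def mat_act_diff)
  with ex cb obtain e where e: "e \<in> strand (F (Suc i)) \<alpha>" "\<And>a. matches U \<alpha> i a \<Longrightarrow> bd i e a = c a - b a"
    by (rule exact_atE) blast+
  have "b a = 0" if "matches (insert x U) \<alpha> i a" for a
  proof (rule ccontr)
    assume "b a \<noteq> 0"
    then have "(F i ! a) x \<le> \<alpha> x - 1" using strandD[OF b(1), of a] by (auto simp: le_fun_def dest!: spec[of _ x])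
    then show False using that by (auto simp: matches_def)
  qed
  then show "\<exists>e. e \<in> strand (F (Suc i)) \<alpha> \<and> (\<forall>a. matches (insert x U) \<alpha> i a \<longrightarrow> bd i e a = c a)"
    using e by (intro exI[of _ e]) (auto simp: matches_def)
qed

text \<open>With all variables fixed only generators of degree exactly \<alpha> match, and by
  minimality the differentials between them vanish. An exact complex with zero differentials is
  zero.\<close>

lemma exact_at_UNIV:
  assumes "exact_at UNIV \<alpha> (Suc i)"
  shows "\<alpha> \<notin> set (F (Suc i))"
proof
  assume "\<alpha> \<in> set (F (Suc i))"
  then obtain b where b: "b < length (F (Suc i))" "F (Suc i) ! b = \<alpha>" by (auto simp: in_set_conv_nth)
  have *: "matches UNIV \<alpha> j a \<longleftrightarrow> a < length (F j) \<and> F j ! a = \<alpha>" for j a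
    by (auto simp: matches_def)
  have s: "std_unit b \<in> strand (F (Suc i)) \<alpha>" using b by (intro std_unit_strand) auto
  have z: "bd i (std_unit b) a = 0" if "F i ! a = \<alpha>" for a
    using bd_matching[OF s that] .
  from assms s obtain e where e: "e \<in> strand (F (Suc (Suc i))) \<alpha>"
      "\<And>a. matches UNIV \<alpha> (Suc i) a \<Longrightarrow> bd (Suc i) e a = std_unit b a"
    using z by (elim exact_atE) (auto simp: * bd_prev_def)
  have "bd (Suc i) e b = 1" using b e(2) by (simp add: * std_unit_def)
  with bd_matching[OF e(1) b(2)] show False by simp
qed

end

section \<open>Linearity for complete and complete bipartite graphs\<close>

context strand_resolution
begin


text \<open>Inserting x asks for exactness at (\<gamma>, i) and at (\<gamma> - e_x, i - 1). The
  latter lowers position and total degree together, so the bound with \<open>m\<close> survives, and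
  since x is outside \<open>U\<^sub>0\<close> the values there stay those of \<alpha>.\<close>

lemma exact_at_extend:
  assumes base: "\<And>\<gamma> i. \<gamma> \<le> \<alpha> \<Longrightarrow> \<forall>u\<in>U\<^sub>0. \<gamma> u = \<alpha> u \<Longrightarrow> int i + m \<le> total_degree \<gamma> \<Longrightarrow> exact_at U\<^sub>0 \<gamma> i"
  shows "int i + m \<le> total_degree \<alpha> \<Longrightarrow> exact_at UNIV \<alpha> i"
proof -
  have "exact_at (U\<^sub>0 \<union> S) \<gamma> i"
    if "finite S" "\<gamma> \<le> \<alpha>" "\<forall>u\<in>U\<^sub>0. \<gamma> u = \<alpha> u" "int i + m \<le> total_degree \<gamma>" for S \<gamma> i
    using that
  proof (induction S arbitrary: \<gamma> i rule: finite_induct)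
    case empty
    then show ?case using base by simp
  next
    case (insert x S)
    show ?case
    proof (cases "x \<in> U\<^sub>0")
      case True
      then show ?thesis using insert by (simp add: insert_absorb)
    next
      case False
      have "exact_at (insert x (U\<^sub>0 \<union> S)) \<gamma> i"
      proof (rule exact_at_insert)
        show "x \<notin> U\<^sub>0 \<union> S" using False insert by simp
        show "exact_at (U\<^sub>0 \<union> S) \<gamma> i" using insert by simp
        assume "0 < i"
        show "exact_at (U\<^sub>0 \<union> S) (\<gamma>(x := \<gamma> x - 1)) (i - 1)"
        proof (rule insert.IH)
          show "\<gamma>(x := \<gamma> x - 1) \<le> \<alpha>" by (rule order_trans[OF lower_le insert.prems(1)])
          show "\<forall>u\<in>U\<^sub>0. (\<gamma>(x := \<gamma> x - 1)) u = \<alpha> u" using insert.prems(2) False by simp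
          show "int (i - 1) + m \<le> total_degree (\<gamma>(x := \<gamma> x - 1))"
            using insert.prems(3) \<open>0 < i\<close> by (simp add: total_degree_upd)
        qed
      qed
      then show ?thesis by simp
    qed
  qed
  from this[of UNIV \<alpha> i] show "int i + m \<le> total_degree \<alpha> \<Longrightarrow> exact_at UNIV \<alpha> i" by simp
qed

text \<open>If x^\<gamma> is in I, so is its quotient by z, and both strands in the Koszul step for
  z are exact everywhere; if it is not, nothing matches at z. This will confine the degrees of
  generators to squarefree ones supported on W.\<close>

lemma redundant_variable:
  assumes z: "\<alpha> z \<noteq> 0" and red: "\<And>\<gamma>. \<gamma> \<le> \<alpha> \<Longrightarrow> \<gamma> z = \<alpha> z \<Longrightarrow> P \<gamma> \<Longrightarrow> P (\<gamma>(z := \<gamma> z - 1))"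
  shows "\<alpha> \<notin> set (F (Suc i))"
\<comment> \<open>This value of \<open>m\<close> turns the degree bound into an equality.\<close>
proof (rule exact_at_UNIV, rule exact_at_extend[where U\<^sub>0 = "{z}" and m = "total_degree \<alpha> - int (Suc i)"])
  fix \<gamma> i assume g: "\<gamma> \<le> \<alpha>" "\<forall>u\<in>{z}. \<gamma> u = \<alpha> u"
  show "exact_at {z} \<gamma> i"
  proof (cases "P \<gamma>")
    case True
    then show ?thesis using red g by (intro exact_at_insert exact_at_empty) auto
  next
    case False
    then show ?thesis using g z by (intro exact_at_no_generators[of _ z]) auto
  qed
qed simp

text \<open>Strands are exact at positive positions, so membership after a division matters only
  when the Koszul steps arrive at position 0. Dividing by a arrives there from i = 1, dividing by
  both a and b from i = 2; with i + 2 \<le> total degree this gives the thresholds 3 and 4.\<close>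

lemma exact_at_pair:
  assumes ab: "a \<noteq> b" "\<gamma> a \<noteq> 0" and P: "P \<gamma>" and i: "int i + 2 \<le> total_degree \<gamma>"
    and a: "3 \<le> total_degree \<gamma> \<Longrightarrow> P (\<gamma>(a := \<gamma> a - 1))"
    and b: "4 \<le> total_degree \<gamma> \<Longrightarrow> P (\<gamma>(b := \<gamma> b - 1)) \<Longrightarrow> P (\<gamma>(b := \<gamma> b - 1, a := \<gamma> a - 1))"
  shows "exact_at {a, b} \<gamma> i"
proof -
  let ?\<beta> = "\<gamma>(b := \<gamma> b - 1)"
  have 1: "exact_at {a} \<gamma> i" using P a i by (intro exact_at_insert exact_at_empty) auto
  have 2: "exact_at {a} ?\<beta> (i - 1)" if "0 < i"
  proof (cases "P ?\<beta>")
    case True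
    have "P (?\<beta>(a := ?\<beta> a - 1)) \<or> 0 < i - 1 - 1" if "0 < i - 1" 
      using that True b i ab(1) by (cases "i = 2") auto
    with True show ?thesis by (intro exact_at_insert exact_at_empty) auto
  next
    case False
    then show ?thesis using ab by (intro exact_at_no_generators[of _ a]) auto
  qed
  have "exact_at (insert b {a}) \<gamma> i" by (rule exact_at_insert) (use ab 1 2 in auto)
  then show ?thesis by (simp add: insert_commute)
qed

end

section \<open>Edge monomials of complete and complete bipartite graphs\<close>

text \<open>Membership of x^\<alpha> in the edge ideal of a graph without loops; for x = y the body
  would ask for exponent 1 where the monomial has exponent 2.\<close>

definition edge_degree :: "'v graph \<Rightarrow> ('v \<Rightarrow> int) \<Rightarrow> bool" where
  "edge_degree G \<alpha> \<longleftrightarrow> (\<forall>z. 0 \<le> \<alpha> z) \<and> (\<exists>x y. {x, y} \<in> edges G \<and> 1 \<le> \<alpha> x \<and> 1 \<le> \<alpha> y)"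

lemma edge_degreeI:
  "{x, y} \<in> edges G \<Longrightarrow> (\<And>z. 0 \<le> \<alpha> z) \<Longrightarrow> 1 \<le> \<alpha> x \<Longrightarrow> 1 \<le> \<alpha> y \<Longrightarrow> edge_degree G \<alpha>"
  by (auto simp: edge_degree_def)

definition loopless :: "'v graph \<Rightarrow> bool" where
  "loopless G \<longleftrightarrow> (\<forall>x. {x} \<notin> edges G)"

lemma total_degree_ge_sum:
  assumes "\<And>z. 0 \<le> \<alpha> z" shows "sum \<alpha> S \<le> total_degree \<alpha>"
  unfolding total_degree_def using assms by (intro sum_mono2) (auto simp: le_fun_def)

lemma edge_degree_total_degree:
  assumes "loopless G" "edge_degree G \<alpha>"
  shows "2 \<le> total_degree \<alpha>"
proof -
  obtain x y where xy: "{x, y} \<in> edges G" "1 \<le> \<alpha> x" "1 \<le> \<alpha> y" "\<And>z. 0 \<le> \<alpha> z"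
    using assms(2) by (auto simp: edge_degree_def)
  then have "x \<noteq> y" using assms(1) by (auto simp: loopless_def)
  then show ?thesis using total_degree_ge_sum[of \<alpha> "{x, y}"] xy by simp
qed

lemma card_support:
  assumes "\<forall>x. \<gamma> x = 0 \<or> \<gamma> x = 1"
  shows "total_degree \<gamma> = int (card {x. \<gamma> x = 1})"
proof -
  have "total_degree \<gamma> = (\<Sum>x\<in>UNIV. if \<gamma> x = 1 then 1 else 0)"
    unfolding total_degree_def using assms by (intro sum.cong) auto
  then show ?thesis by (simp add: sum.If_cases)
qed

lemma obtain_outside:
  assumes "\<forall>x. \<gamma> x = 0 \<or> \<gamma> x = 1" "finite S" "int (card S) < total_degree \<gamma>"
  shows "\<exists>c. c \<notin> S \<and> \<gamma> c = 1"
proof -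
  have "\<not> {x. \<gamma> x = 1} \<subseteq> S"
    using card_mono[OF assms(2), of "{x. \<gamma> x = 1}"] assms(3) card_support[OF assms(1)] by auto
  then show ?thesis by blast
qed

definition complete_or_bipartite :: "'v set \<Rightarrow> 'v graph \<Rightarrow> bool" where
  "complete_or_bipartite W H \<longleftrightarrow> H = complete_graph W \<or>
     (\<exists>X Y. X \<noteq> {} \<and> Y \<noteq> {} \<and> X \<inter> Y = {} \<and> X \<union> Y = W \<and> H = complete_bipartite_graph X Y)"

lemma loopless_complete_or_bipartite: "complete_or_bipartite W H \<Longrightarrow> loopless H"
  unfolding complete_or_bipartite_def loopless_def complete_graph_def complete_bipartite_graph_def
  by (auto simp: doubleton_eq_iff)

lemma edges_complete_or_bipartite: "complete_or_bipartite W H \<Longrightarrow> {x, y} \<in> edges H \<Longrightarrow> x \<in> W \<and> y \<in> W"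
  unfolding complete_or_bipartite_def complete_graph_def complete_bipartite_graph_def
  by (auto simp: doubleton_eq_iff)

text \<open>These are the conditions of \<open>exact_at_pair\<close>, and the point is the order of
  the endpoints. In a complete graph any two remaining vertices are adjacent and the order is free.
  In the bipartite case an endpoint that is alone on its side of the support is taken as q: every
  third vertex of the support is adjacent to q, while dividing by q leaves the ideal and makes the
  second condition void.\<close>

lemma edge_removal:
  fixes \<gamma> :: "'v::finite \<Rightarrow> int"
  assumes H: "complete_or_bipartite W H" and ab: "{a, b} \<in> edges H" "\<gamma> a = 1" "\<gamma> b = 1"
    and g: "\<And>x. \<gamma> x = 0 \<or> \<gamma> x = 1" and W: "\<And>x. \<gamma> x \<noteq> 0 \<Longrightarrow> x \<in> W"
  obtains p q where "{p, q} = {a, b}" "3 \<le> total_degree \<gamma> \<Longrightarrow> edge_degree H (\<gamma>(p := \<gamma> p - 1))"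
    "4 \<le> total_degree \<gamma> \<Longrightarrow> edge_degree H (\<gamma>(q := \<gamma> q - 1)) \<Longrightarrow> edge_degree H (\<gamma>(q := \<gamma> q - 1, p := \<gamma> p - 1))"
proof -
  have neq: "a \<noteq> b" using loopless_complete_or_bipartite[OF H] ab(1) by (auto simp: loopless_def)
  have g0: "\<forall>x. \<gamma> x = 0 \<or> \<gamma> x = 1" using g by blast
  have ge: "\<gamma> x \<ge> 0" for x using g[of x] by auto
  have ED1: "edge_degree H (\<gamma>(p := \<gamma> p - 1))"
    if "\<gamma> p = 1" "{x, y} \<in> edges H" "\<gamma> x = 1" "\<gamma> y = 1" "x \<noteq> p" "y \<noteq> p" for p x y
    by (rule edge_degreeI[OF that(2)]) (use that ge in auto)
  have ED2: "edge_degree H (\<gamma>(q := \<gamma> q - 1, p := \<gamma> p - 1))"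
    if "\<gamma> p = 1" "\<gamma> q = 1" "{x, y} \<in> edges H" "\<gamma> x = 1" "\<gamma> y = 1" "x \<noteq> p" "y \<noteq> p" "x \<noteq> q" "y \<noteq> q" for p q x y
    by (rule edge_degreeI[OF that(3)]) (use that ge in auto)
  from H[unfolded complete_or_bipartite_def] show thesis
  proof (elim disjE exE conjE)
    assume H: "H = complete_graph W"
    have E: "{x, y} \<in> edges H" if "\<gamma> x = 1" "\<gamma> y = 1" "x \<noteq> y" for x y
      using that W[of x] W[of y] unfolding H complete_graph_def by auto
    show thesis
    proof (rule that[OF refl])
      assume "3 \<le> total_degree \<gamma>"
      then obtain c where "c \<notin> {a, b}" "\<gamma> c = 1"
        using obtain_outside[OF g0, of "{a, b}"] neq by auto
      then show "edge_degree H (\<gamma>(a := \<gamma> a - 1))" using ab neq E by (intro ED1[of a b c]) auto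
    next
      assume "4 \<le> total_degree \<gamma>"
      then obtain c where c: "c \<notin> {a, b}" "\<gamma> c = 1"
        using obtain_outside[OF g0, of "{a, b}"] neq by auto
      then obtain d where "d \<notin> {a, b, c}" "\<gamma> d = 1"
        using obtain_outside[OF g0, of "{a, b, c}"] neq \<open>4 \<le> total_degree \<gamma>\<close> by auto
      with c show "edge_degree H (\<gamma>(b := \<gamma> b - 1, a := \<gamma> a - 1))" using ab neq E by (intro ED2[of a b c d]) auto
    qed
  next
    fix X Y assume XY: "X \<inter> Y = {}" "X \<union> Y = W" and H: "H = complete_bipartite_graph X Y"
    have E: "{x, y} \<in> edges H \<longleftrightarrow> x \<in> X \<and> y \<in> Y \<or> x \<in> Y \<and> y \<in> X" for x y
      unfolding H complete_bipartite_graph_def by (auto simp: doubleton_eq_iff)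
    obtain a' b' where ab': "{a', b'} = {a, b}" "a' \<in> X" "b' \<in> Y"
      using E[of a b] ab(1) by (auto simp: insert_commute)
    then have g': "\<gamma> a' = 1" "\<gamma> b' = 1" "a' \<noteq> b'" using ab XY by (auto simp: doubleton_eq_iff)
    note ED1' = ED1[unfolded E] and ED2' = ED2[unfolded E]
    note goal = that
    have key: thesis
      if p: "{p, q} = {a, b}" "\<gamma> p = 1" "\<gamma> q = 1" "p \<noteq> q" "p \<in> A" "q \<in> B"
        "A = X \<and> B = Y \<or> A = Y \<and> B = X" and only: "\<And>x. x \<in> B \<Longrightarrow> \<gamma> x = 1 \<Longrightarrow> x = q" for p q A B
    proof (rule goal[OF p(1)])
      assume "3 \<le> total_degree \<gamma>"
      then obtain c where "c \<notin> {p, q}" "\<gamma> c = 1"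
        using obtain_outside[OF g0, of "{p, q}"] p(4) by auto
      then show "edge_degree H (\<gamma>(p := \<gamma> p - 1))"
        using p(2-7) only[of c] W[of c] XY by (intro ED1[of p c q]) (auto simp: E)
    next
      assume "edge_degree H (\<gamma>(q := \<gamma> q - 1))"
      then obtain x y where xy: "{x, y} \<in> edges H" "1 \<le> (\<gamma>(q := \<gamma> q - 1)) x" "1 \<le> (\<gamma>(q := \<gamma> q - 1)) y"
        by (auto simp: edge_degree_def)
      then have "x \<noteq> q" "y \<noteq> q" "\<gamma> x = 1" "\<gamma> y = 1" using p(3) g[of x] g[of y] by (auto split: if_splits)
      then have False using xy(1) p(7) only[of x] only[of y] by (auto simp: E)
      then show "edge_degree H (\<gamma>(q := \<gamma> q - 1, p := \<gamma> p - 1))" ..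
    qed
    \<comment> \<open>In the last case c and d span an edge disjoint from the chosen one, and it
      survives both divisions.\<close>
    consider "\<forall>x\<in>Y. \<gamma> x = 1 \<longrightarrow> x = b'" | "\<forall>x\<in>X. \<gamma> x = 1 \<longrightarrow> x = a'"
      | c d where "c \<in> X" "\<gamma> c = 1" "c \<noteq> a'" "d \<in> Y" "\<gamma> d = 1" "d \<noteq> b'" by blast
    then show thesis
    proof cases
      case 1
      then show ?thesis by (intro key[of a' b' X Y] ab' g') blast+
    next
      case 2
      then show ?thesis by (intro key[of b' a' Y X] ab' g' g'(3)[symmetric]) (use ab'(1) in blast)+
    next
      case 3
      then have n: "c \<noteq> b'" "d \<noteq> a'" using ab' XY by auto
      show ?thesis
      proof (rule that[OF ab'(1)])
        show "edge_degree H (\<gamma>(a' := \<gamma> a' - 1))"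
          using 3 n ab' g' by (intro ED1[of a' c b']) (auto simp: E)
        show "edge_degree H (\<gamma>(b' := \<gamma> b' - 1, a' := \<gamma> a' - 1))"
          using 3 n ab' g' by (intro ED2[of a' b' c d]) (auto simp: E)
      qed
    qed
  qed
qed

text \<open>The hypothesis on \<open>P\<close> only concerns degrees below \<alpha>, so that the
  bound also covers an ideal agreeing with I(H) there. With the general lower bound it pins the
  total degree to i + 2.\<close>

lemma (in strand_resolution) linear_generators:
  assumes H: "complete_or_bipartite W H" and P: "\<And>\<gamma>. \<gamma> \<le> \<alpha> \<Longrightarrow> P \<gamma> \<longleftrightarrow> edge_degree H \<gamma>"
    and gen: "\<alpha> \<in> set (F (Suc i))"
  shows "total_degree \<alpha> < int i + 3"
proof (rule ccontr)
  assume big: "\<not> total_degree \<alpha> < int i + 3"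
  have "P \<alpha>" using gen generator_P by (auto simp: in_set_conv_nth)
  then obtain a b where ab: "{a, b} \<in> edges H" "1 \<le> \<alpha> a" "1 \<le> \<alpha> b" and ge: "\<And>z. 0 \<le> \<alpha> z"
    using P by (auto simp: edge_degree_def)
  have neq: "a \<noteq> b" using loopless_complete_or_bipartite[OF H] ab(1) by (auto simp: loopless_def)
  \<comment> \<open>A variable outside W, or with exponent at least 2, can be cancelled once without
    leaving the ideal, so \<open>redundant_variable\<close> excludes it.\<close>
  have nz: "\<alpha> z = 0 \<or> \<alpha> z = 1 \<and> z \<in> W" for z
  proof (rule ccontr)
    assume z: "\<not> ?thesis"
    have "\<alpha> \<notin> set (F (Suc i))"
    proof (rule redundant_variable[of _ z])
      show "\<alpha> z \<noteq> 0" using z by simp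
      fix \<gamma> assume g: "\<gamma> \<le> \<alpha>" "\<gamma> z = \<alpha> z" "P \<gamma>"
      then obtain x y where xy: "{x, y} \<in> edges H" "1 \<le> \<gamma> x" "1 \<le> \<gamma> y" "\<And>z. 0 \<le> \<gamma> z"
        using P by (auto simp: edge_degree_def)
      have xyW: "x \<in> W" "y \<in> W" using edges_complete_or_bipartite[OF H xy(1)] by auto
      have z1: "1 \<le> \<alpha> z" using z ge[of z] by auto
      have z2: "z \<in> W \<Longrightarrow> 2 \<le> \<alpha> z" using z z1 by auto
      have le: "\<gamma>(z := \<gamma> z - 1) \<le> \<alpha>" using g(1,2) by (auto simp: le_fun_def)
      have "edge_degree H (\<gamma>(z := \<gamma> z - 1))"
        by (rule edge_degreeI[OF xy(1)]) (use xy xyW z1 z2 g(2) in auto)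
      then show "P (\<gamma>(z := \<gamma> z - 1))" using P[OF le] by simp
    qed
    with gen show False by blast
  qed
  have a1: "\<alpha> a = 1" "\<alpha> b = 1" using nz[of a] nz[of b] ab by auto
  have "exact_at UNIV \<alpha> (Suc i)"
  \<comment> \<open>The endpoints of an edge are fixed before all other variables, because for them
    membership after division is under control; \<open>m = 2\<close> is the bound of
    \<open>exact_at_pair\<close>.\<close>
  proof (rule exact_at_extend[where U\<^sub>0 = "{a, b}" and m = 2])
    show "int (Suc i) + 2 \<le> total_degree \<alpha>" using big by simp
    fix \<gamma> i assume g: "\<gamma> \<le> \<alpha>" "\<forall>u\<in>{a, b}. \<gamma> u = \<alpha> u" and i: "int i + 2 \<le> total_degree \<gamma>"
    show "exact_at {a, b} \<gamma> i"
    proof (cases "P \<gamma>")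
      case False
      then show ?thesis using g(2) a1 by (intro exact_at_no_generators[of _ a]) auto
    next
      case True
      then have ge: "0 \<le> \<gamma> z" for z using P[OF g(1)] by (auto simp: edge_degree_def)
      have g1: "\<gamma> x = 0 \<or> \<gamma> x = 1" for x
        using ge[of x] g(1) nz[of x] by (auto simp: le_fun_def dest!: spec[of _ x])
      have gW: "x \<in> W" if "\<gamma> x \<noteq> 0" for x
        using ge[of x] g(1) nz[of x] that by (auto simp: le_fun_def dest!: spec[of _ x])
      have gab: "\<gamma> a = 1" "\<gamma> b = 1" using g(2) a1 by auto
      obtain p q where pq: "{p, q} = {a, b}" "3 \<le> total_degree \<gamma> \<Longrightarrow> edge_degree H (\<gamma>(p := \<gamma> p - 1))"
        "4 \<le> total_degree \<gamma> \<Longrightarrow> edge_degree H (\<gamma>(q := \<gamma> q - 1)) \<Longrightarrow> edge_degree H (\<gamma>(q := \<gamma> q - 1, p := \<gamma> p - 1))"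
        by (rule edge_removal[where \<gamma> = \<gamma>, OF H ab(1) gab g1 gW]) (assumption, erule that, simp_all)
      have le: "\<gamma>(x := \<gamma> x - 1) \<le> \<alpha>" for x
        by (rule order_trans[OF lower_le g(1)])
      have le': "\<gamma>(q := \<gamma> q - 1, p := \<gamma> p - 1) \<le> \<alpha>" if "p \<noteq> q"
        using order_trans[OF lower_le[of "\<gamma>(q := \<gamma> q - 1)" p] le[of q]] that by simp
      have "exact_at {p, q} \<gamma> i"
      proof (rule exact_at_pair)
        show n: "p \<noteq> q" and "\<gamma> p \<noteq> 0" using pq(1) neq g(2) a1 by (auto simp: doubleton_eq_iff)
        show "P \<gamma>" "int i + 2 \<le> total_degree \<gamma>" using True i by auto
        show "P (\<gamma>(p := \<gamma> p - 1))" if "3 \<le> total_degree \<gamma>" using pq(2)[OF that] P[OF le] by simp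
        show "P (\<gamma>(q := \<gamma> q - 1, p := \<gamma> p - 1))" if "4 \<le> total_degree \<gamma>" "P (\<gamma>(q := \<gamma> q - 1))"
          using pq(3)[OF that(1)] that(2) P[OF le] P[OF le'[OF n]] by simp
      qed
      then show ?thesis using pq(1) by simp
    qed
  qed
  with gen exact_at_UNIV show False by blast
qed

section \<open>Comparison of linear strands\<close>

text \<open>Gaussian elimination: \<open>\<Psi>\<close> is the system after removing the unknown p
  by means of row a, and \<open>d\<close> recovers the value at p from that row.\<close>

lemma homogeneous_system_solution:
  fixes \<Phi> :: "'a \<Rightarrow> 'b \<Rightarrow> 'k::field"
  assumes "finite A"
  shows "finite B \<Longrightarrow> card A < card B \<Longrightarrow>
    \<exists>c. (\<exists>b\<in>B. c b \<noteq> 0) \<and> (\<forall>a\<in>A. (\<Sum>b\<in>B. \<Phi> a b * c b) = 0)"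
  using assms
proof (induction A arbitrary: B \<Phi> rule: finite_induct)
  case empty
  then obtain b where "b \<in> B" by (metis card.empty ex_in_conv less_irrefl)
  then show ?case by (intro exI[of _ "\<lambda>_. 1"]) auto
next
  case (insert a A)
  show ?case
  proof (cases "\<forall>b\<in>B. \<Phi> a b = 0")
    case True
    have "card A < card B" using insert by simp
    with insert.IH[OF insert.prems(1)] obtain c where
      "\<exists>b\<in>B. c b \<noteq> 0" "\<forall>a\<in>A. (\<Sum>b\<in>B. \<Phi> a b * c b) = 0" by blast
    with True show ?thesis by (intro exI[of _ c]) simp
  next
    case False
    then obtain p where p: "p \<in> B" "\<Phi> a p \<noteq> 0" by blast
    define \<Psi> where "\<Psi> a' b = \<Phi> a' b - \<Phi> a' p * \<Phi> a b / \<Phi> a p" for a' b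
    have "card A < card (B - {p})" using insert p by (simp add: card_Diff_singleton)
    with insert.IH[of "B - {p}" \<Psi>] insert.prems(1) obtain c where
      c: "\<exists>b\<in>B - {p}. c b \<noteq> 0" "\<forall>a'\<in>A. (\<Sum>b\<in>B - {p}. \<Psi> a' b * c b) = 0" by auto
    define d where "d b = (if b = p then - (\<Sum>b\<in>B - {p}. \<Phi> a b * c b) / \<Phi> a p else c b)" for b
    have split: "(\<Sum>b\<in>B. \<Phi> a' b * d b) =
        \<Phi> a' p * (- (\<Sum>b\<in>B - {p}. \<Phi> a b * c b) / \<Phi> a p) + (\<Sum>b\<in>B - {p}. \<Phi> a' b * c b)" for a'
    proof -
      have "(\<Sum>b\<in>B - {p}. \<Phi> a' b * d b) = (\<Sum>b\<in>B - {p}. \<Phi> a' b * c b)"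
        by (intro sum.cong) (auto simp: d_def)
      then show ?thesis using sum.remove[OF insert.prems(1) p(1), of "\<lambda>b. \<Phi> a' b * d b"]
        by (simp add: d_def)
    qed
    have "(\<Sum>b\<in>B. \<Phi> a' b * d b) = 0" if "a' \<in> A" for a'
    proof -
      have "0 = (\<Sum>b\<in>B - {p}. \<Psi> a' b * c b)" using c(2) that by simp
      also have "\<dots> = (\<Sum>b\<in>B - {p}. \<Phi> a' b * c b - \<Phi> a' p / \<Phi> a p * (\<Phi> a b * c b))"
        by (intro sum.cong) (auto simp: \<Psi>_def algebra_simps)
      also have "\<dots> = (\<Sum>b\<in>B. \<Phi> a' b * d b)"
        unfolding split by (simp add: sum_subtractf sum_distrib_left sum_divide_distrib)
      finally show ?thesis by simp
    qed
    moreover have "(\<Sum>b\<in>B. \<Phi> a b * d b) = 0" unfolding split using p(2) by simp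
    moreover have "\<exists>b\<in>B. d b \<noteq> 0" using c(1) by (auto simp: d_def)
    ultimately show ?thesis by (intro exI[of _ d]) auto
  qed
qed

lemma count_list_card: "count_list xs x = card {b. b < length xs \<and> xs ! b = x}"
  unfolding count_list_eq_length_filter length_filter_conv_card by (simp add: eq_commute)

lemma mat_act_units:
  assumes "\<And>b. c b \<noteq> 0 \<Longrightarrow> b < n"
  shows "mat_act n A c a = (\<Sum>b<n. c b * mat_act n A (std_unit b) a)"
  unfolding mat_act_def[of n A c] by (intro sum.cong) (auto simp: mat_act_unit)

context strand_resolution
begin

text \<open>Exactness in one form for all positions; at position 0 it is the augmentation, where
  x^\<alpha> has to be in the ideal.\<close>

lemma bd_prev_lift:
  assumes P: "P \<alpha>" and c: "c \<in> strand (F j) \<alpha>" and z: "bd_prev j c = (\<lambda>_. 0)"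
  obtains e where "e \<in> strand (F (Suc j)) \<alpha>" "bd j e = c"
proof (cases j)
  case 0
  then have "c \<in> strand (F 0) \<alpha>" using c by simp
  with P obtain e where "e \<in> strand (F 1) \<alpha>" "bd 0 e = c" by (rule aug_lift)
  with 0 show thesis using that by simp
next
  case (Suc i)
  then have "c \<in> strand (F (Suc i)) \<alpha>" "bd i c = (\<lambda>_. 0)" using c z by (auto simp: bd_prev_def)
  then obtain e where "e \<in> strand (F (Suc (Suc i))) \<alpha>" "bd (Suc i) e = c" by (rule kernel_lift)
  with Suc show thesis using that by simp
qed

lemma bd_prev_bd: "c \<in> strand (F (Suc j)) \<alpha> \<Longrightarrow> bd_prev j (bd j c) = (\<lambda>_. 0)"
  by (cases j) (auto simp: bd_prev_def bd_bd)

end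

text \<open>The inclusion of ideals is lifted to a map of resolutions. On the lowest diagonal its
  entries join generators of equal degree only, as the target has none of smaller total degree.
  Injectivity climbs: a kernel element has its boundary in the kernel one position lower, so that
  boundary is zero, and minimality kills the element.\<close>

lemma linear_strand_count_le:
  fixes L L' :: "nat \<Rightarrow> nat \<Rightarrow> nat \<Rightarrow> 'k::field"
  assumes R: "strand_resolution P F L" and R': "strand_resolution P' F' L'"
    and two: "\<And>\<alpha>. P \<alpha> \<Longrightarrow> 2 \<le> total_degree \<alpha>" and two': "\<And>\<alpha>. P' \<alpha> \<Longrightarrow> 2 \<le> total_degree \<alpha>"
    and imp: "\<And>\<gamma>. \<gamma> \<le> \<alpha>\<^sub>0 \<Longrightarrow> P \<gamma> \<Longrightarrow> P' \<gamma>" and lin: "total_degree \<alpha>\<^sub>0 = int i + 2"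
  shows "count_list (F (Suc i)) \<alpha>\<^sub>0 \<le> count_list (F' (Suc i)) \<alpha>\<^sub>0"
proof -
  interpret R: strand_resolution P F L by (rule R)
  interpret R': strand_resolution P' F' L' by (rule R')
  \<comment> \<open>Position j is homological degree j - 1 of the ideal, whose lowest total degree
    is j + 1; position 0 is the ring.\<close>
  define good where "good j \<gamma> \<longleftrightarrow> j = 0 \<or> \<gamma> \<le> \<alpha>\<^sub>0 \<and> total_degree \<gamma> = int j + 1" for j \<gamma>
  define lins where "lins j = {c::nat \<Rightarrow> 'k. \<forall>b. c b \<noteq> 0 \<longrightarrow> b < length (F j) \<and> good j (F j ! b)}" for j
  have bd_lins: "R.bd j c \<in> lins j" if c: "c \<in> lins (Suc j)" for j c
    unfolding lins_def
  proof (intro CollectI allI impI)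
    fix a assume "R.bd j c a \<noteq> 0"
    then obtain b where b: "b < length (F (Suc j))" "a < length (F j)" "c b \<noteq> 0" "F j ! a < F (Suc j) ! b"
      by (rule R.bd_nonzero)
    have g: "F (Suc j) ! b \<le> \<alpha>\<^sub>0" "total_degree (F (Suc j) ! b) = int j + 2"
      using c b(3) by (auto simp: lins_def good_def)
    have "good j (F j ! a)"
    proof (cases j)
      case (Suc k)
      have "int k + 2 \<le> total_degree (F j ! a)" using R.generator_total_degree[OF two] b(2) Suc by auto
      then show ?thesis using total_degree_less[OF b(4)] g Suc less_imp_le[OF b(4)] by (auto simp: good_def)
    qed (simp add: good_def)
    with b show "a < length (F j) \<and> good j (F j ! a)" by simp
  qed
  \<comment> \<open>Sending cycles to cycles stands in for commutation with the previous map, so the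
    induction speaks of one position at a time.\<close>
  have "\<exists>\<Phi>. (\<forall>a b. \<Phi> a b \<noteq> 0 \<longrightarrow> a < length (F' j) \<and> b < length (F j) \<and> F' j ! a = F j ! b) \<and>
      (\<forall>c\<in>lins j. mat_act (length (F j)) \<Phi> c = (\<lambda>_. 0) \<longrightarrow> c = (\<lambda>_. 0)) \<and>
      (\<forall>c\<in>lins j. R.bd_prev j c = (\<lambda>_. 0) \<longrightarrow> R'.bd_prev j (mat_act (length (F j)) \<Phi> c) = (\<lambda>_. 0))" for j
  proof (induction j)
    case 0
    define \<Phi> :: "nat \<Rightarrow> nat \<Rightarrow> 'k" where "\<Phi> a b = (if a = 0 \<and> b = 0 then 1 else 0)" for a b
    have "c = (\<lambda>_. 0)" if c: "c \<in> lins 0" and z: "mat_act (length (F 0)) \<Phi> c = (\<lambda>_. 0)" for c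
    proof
      fix b
      have "mat_act (length (F 0)) \<Phi> c 0 = c 0" by (simp add: mat_act_def R.F0 \<Phi>_def)
      then have "c 0 = 0" using z by simp
      then show "c b = 0" using c by (cases "b = 0") (auto simp: lins_def R.F0)
    qed
    moreover have "a < length (F' 0) \<and> b < length (F 0) \<and> F' 0 ! a = F 0 ! b" if "\<Phi> a b \<noteq> 0" for a b
      using that by (auto simp: \<Phi>_def R.F0 R'.F0 split: if_splits)
    moreover have "R'.bd_prev 0 c = (\<lambda>_. 0)" for c by (simp add: R'.bd_prev_def)
    ultimately show ?case by (intro exI[of _ \<Phi>]) blast
  next
    case (Suc j)
    then obtain \<Phi> where block: "\<And>a b. \<Phi> a b \<noteq> 0 \<Longrightarrow> a < length (F' j) \<and> b < length (F j) \<and> F' j ! a = F j ! b"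
      and inj: "\<And>c. c \<in> lins j \<Longrightarrow> mat_act (length (F j)) \<Phi> c = (\<lambda>_. 0) \<Longrightarrow> c = (\<lambda>_. 0)"
      and ker: "\<And>c. c \<in> lins j \<Longrightarrow> R.bd_prev j c = (\<lambda>_. 0) \<Longrightarrow> R'.bd_prev j (mat_act (length (F j)) \<Phi> c) = (\<lambda>_. 0)"
      by blast
    let ?\<Phi> = "mat_act (length (F j)) \<Phi>"
    let ?good = "\<lambda>b. b < length (F (Suc j)) \<and> good (Suc j) (F (Suc j) ! b)"
    have "\<exists>w. w \<in> strand (F' (Suc j)) (F (Suc j) ! b) \<and> R'.bd j w = ?\<Phi> (R.bd j (std_unit b))"
      if b: "?good b" for b
    proof -
      let ?\<gamma> = "F (Suc j) ! b"
      have u: "std_unit b \<in> lins (Suc j)" "std_unit b \<in> strand (F (Suc j)) ?\<gamma>"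
        using b by (auto simp: lins_def std_unit_def) (simp add: std_unit_strand flip: std_unit_def)
      have s: "R.bd j (std_unit b) \<in> strand (F j) ?\<gamma>" by (rule R.bd_strand[OF u(2)])
      have s': "?\<Phi> (R.bd j (std_unit b)) \<in> strand (F' j) ?\<gamma>"
      proof (rule strandI)
        fix a assume "?\<Phi> (R.bd j (std_unit b)) a \<noteq> 0"
        from mat_act_nonzero[OF this] obtain b' where "\<Phi> a b' \<noteq> 0" "R.bd j (std_unit b) b' \<noteq> 0" by blast
        with block[of a b'] strandD[OF s, of b'] show "a < length (F' j) \<and> F' j ! a \<le> ?\<gamma>" by auto
      qed
      have z: "R'.bd_prev j (?\<Phi> (R.bd j (std_unit b))) = (\<lambda>_. 0)"
        by (rule ker[OF bd_lins[OF u(1)] R.bd_prev_bd[OF u(2)]])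
      have P': "P' ?\<gamma>" using imp R.generator_P b by (auto simp: good_def)
      obtain w where "w \<in> strand (F' (Suc j)) ?\<gamma>" "R'.bd j w = ?\<Phi> (R.bd j (std_unit b))"
        by (rule R'.bd_prev_lift[OF P' s' z])
      then show ?thesis by blast
    qed
    then obtain w where w: "\<And>b. ?good b \<Longrightarrow> w b \<in> strand (F' (Suc j)) (F (Suc j) ! b)"
      "\<And>b. ?good b \<Longrightarrow> R'.bd j (w b) = ?\<Phi> (R.bd j (std_unit b))" by metis
    \<comment> \<open>Columns off the linear strand are set to 0; no lift was chosen for
      them.\<close>
    define \<Psi> where "\<Psi> a b = (if ?good b then w b a else 0)" for a b
    let ?\<Psi> = "mat_act (length (F (Suc j))) \<Psi>"
    have block': "a < length (F' (Suc j)) \<and> b < length (F (Suc j)) \<and> F' (Suc j) ! a = F (Suc j) ! b"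
      if "\<Psi> a b \<noteq> 0" for a b
    proof -
      have b: "?good b" "w b a \<noteq> 0" using that by (auto simp: \<Psi>_def split: if_splits)
      have a: "a < length (F' (Suc j))" "F' (Suc j) ! a \<le> F (Suc j) ! b" using strandD[OF w(1)[OF b(1)] b(2)] by auto
      \<comment> \<open>The lift only involves degrees below that of b, and the target has nothing
        of smaller total degree at this position; hence the degrees coincide.\<close>
      have "total_degree (F (Suc j) ! b) \<le> total_degree (F' (Suc j) ! a)"
        using R'.generator_total_degree[OF two' a(1)] b(1) by (auto simp: good_def)
      then show ?thesis using a b total_degree_le_eq[OF a(2)] by auto
    qed
    have comm: "R'.bd j (?\<Psi> c) = ?\<Phi> (R.bd j c)" if c: "c \<in> lins (Suc j)" for c
    proof
      fix a
      have cb: "c b \<noteq> 0 \<Longrightarrow> ?good b" for b using c by (auto simp: lins_def)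
      have "?\<Psi> c = (\<lambda>a. \<Sum>b<length (F (Suc j)). c b * w b a)"
        unfolding mat_act_def by (intro ext sum.cong) (use cb in \<open>auto simp: \<Psi>_def\<close>)
      then have "R'.bd j (?\<Psi> c) a = (\<Sum>b<length (F (Suc j)). c b * R'.bd j (w b) a)"
        by (simp add: R'.bd_def mat_act_sum mat_act_scale)
      also have "\<dots> = (\<Sum>b<length (F (Suc j)). c b * ?\<Phi> (R.bd j (std_unit b)) a)"
        by (intro sum.cong) (use cb w(2) in fastforce)+
      also have "\<dots> = ?\<Phi> (\<lambda>a. \<Sum>b<length (F (Suc j)). c b * R.bd j (std_unit b) a) a"
        by (simp add: mat_act_sum mat_act_scale)
      also have "(\<lambda>a. \<Sum>b<length (F (Suc j)). c b * R.bd j (std_unit b) a) = R.bd j c"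
        unfolding R.bd_def by (intro ext mat_act_units[symmetric]) (use cb in blast)
      finally show "R'.bd j (?\<Psi> c) a = ?\<Phi> (R.bd j c) a" .
    qed
    have "c = (\<lambda>_. 0)" if c: "c \<in> lins (Suc j)" and z: "?\<Psi> c = (\<lambda>_. 0)" for c
    proof (rule ccontr)
      assume "c \<noteq> (\<lambda>_. 0)"
      then obtain b where b: "c b \<noteq> 0" by blast
      let ?\<gamma> = "F (Suc j) ! b"
      \<comment> \<open>As \<open>\<Psi>\<close> preserves degrees, its kernel splits by degree. One
        homogeneous piece of c lies in a single strand, which is where \<open>kernel_minimal\<close>
        applies.\<close>
      define d where "d b = (if F (Suc j) ! b = ?\<gamma> then c b else 0)" for b
      have d: "d \<in> lins (Suc j)" "d \<in> strand (F (Suc j)) ?\<gamma>"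
        using c by (auto simp: d_def lins_def strand_def)
      have "?\<Psi> d a = 0" for a
      proof (cases "F' (Suc j) ! a = ?\<gamma>")
        case True
        have "?\<Psi> d a = ?\<Psi> c a" unfolding mat_act_def
        proof (rule sum.cong)
          fix b' show "\<Psi> a b' * d b' = \<Psi> a b' * c b'"
            using block'[of a b'] True by (cases "\<Psi> a b' = 0") (auto simp: d_def)
        qed simp
        then show ?thesis using z by simp
      next
        case False
        have "\<Psi> a b' * d b' = 0" for b'
          using block'[of a b'] False by (cases "\<Psi> a b' = 0") (auto simp: d_def)
        then show ?thesis by (simp add: mat_act_def)
      qed
      then have "?\<Psi> d = (\<lambda>_. 0)" by (rule ext)
      then have "?\<Phi> (R.bd j d) = (\<lambda>_. 0)" using comm[OF d(1)] by (simp add: R'.bd_def)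
      then have "R.bd j d = (\<lambda>_. 0)" using inj bd_lins[OF d(1)] by blast
      from R.kernel_minimal[OF d(2) this, of b] have "d b = 0" using c b by (auto simp: lins_def)
      then show False using b by (simp add: d_def)
    qed
    moreover have "R'.bd_prev (Suc j) (?\<Psi> c) = (\<lambda>_. 0)" if c: "c \<in> lins (Suc j)" and z: "R.bd_prev (Suc j) c = (\<lambda>_. 0)" for c
      using comm[OF c] z by (simp add: R.bd_prev_def R'.bd_prev_def)
    ultimately show ?case using block' by (intro exI[of _ \<Psi>]) blast
  qed
  from this[of "Suc i"] obtain \<Phi>
    where block: "\<And>a b. \<Phi> a b \<noteq> 0 \<Longrightarrow> F' (Suc i) ! a = F (Suc i) ! b \<and> a < length (F' (Suc i))"
      and inj: "\<And>c. c \<in> lins (Suc i) \<Longrightarrow> mat_act (length (F (Suc i))) \<Phi> c = (\<lambda>_. 0) \<Longrightarrow> c = (\<lambda>_. 0)"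
    by blast
  define A where "A = {a. a < length (F' (Suc i)) \<and> F' (Suc i) ! a = \<alpha>\<^sub>0}"
  define B where "B = {b. b < length (F (Suc i)) \<and> F (Suc i) ! b = \<alpha>\<^sub>0}"
  have fin: "finite A" "finite B" by (auto simp: A_def B_def)
  show ?thesis
  proof (rule ccontr)
    assume "\<not> ?thesis"
    then have "card A < card B" by (simp add: count_list_card A_def B_def)
    from homogeneous_system_solution[OF fin this, of \<Phi>] obtain c where
      c: "\<exists>b\<in>B. c b \<noteq> 0" "\<forall>a\<in>A. (\<Sum>b\<in>B. \<Phi> a b * c b) = 0" by blast
    define d where "d b = (if b \<in> B then c b else 0)" for b
    have d: "d \<in> lins (Suc i)" using lin by (auto simp: lins_def d_def B_def good_def)
    have "mat_act (length (F (Suc i))) \<Phi> d a = 0" for a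
    proof -
      have "mat_act (length (F (Suc i))) \<Phi> d a = (\<Sum>b\<in>B. \<Phi> a b * c b)"
        unfolding mat_act_def d_def by (rule sum.mono_neutral_cong_right) (auto simp: B_def)
      also have "\<dots> = 0"
      proof (cases "a \<in> A")
        case False
        have "\<Phi> a b = 0" if "b \<in> B" for b
          using block[of a b] False that by (auto simp: A_def B_def)
        then show ?thesis by simp
      qed (use c in simp)
      finally show ?thesis .
    qed
    then have "mat_act (length (F (Suc i))) \<Phi> d = (\<lambda>_. 0)" by (rule ext)
    from inj[OF d this] c(1) show False by (metis d_def)
  qed
qed

section \<open>Existence of resolutions in scalar form\<close>

text \<open>Induction on the number of coordinates: one vector with nonzero last entry reduces all
  others to the subspace where this entry vanishes. Closure under c - r d packs linearity into one
  condition.\<close>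

lemma finite_spanning_set:
  fixes V :: "(nat \<Rightarrow> 'k::field) set"
  assumes "\<And>c d r. c \<in> V \<Longrightarrow> d \<in> V \<Longrightarrow> (\<lambda>a. c a - r * d a) \<in> V"
    and "\<And>c a. c \<in> V \<Longrightarrow> c a \<noteq> 0 \<Longrightarrow> a < n"
  shows "\<exists>S. finite S \<and> S \<subseteq> V \<and> (\<forall>c\<in>V. \<exists>e. \<forall>a. c a = (\<Sum>s\<in>S. s a * e s))"
  using assms
proof (induction n arbitrary: V)
  case 0
  have "c a = 0" if "c \<in> V" for c a using 0(2)[OF that, of a] by auto
  then show ?case by (intro exI[of _ "{}"]) auto
next
  case (Suc n)
  define V0 where "V0 = {c \<in> V. c n = 0}"
  have "\<exists>S. finite S \<and> S \<subseteq> V0 \<and> (\<forall>c\<in>V0. \<exists>e. \<forall>a. c a = (\<Sum>s\<in>S. s a * e s))"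
  proof (rule Suc.IH)
    show "(\<lambda>a. c a - r * d a) \<in> V0" if "c \<in> V0" "d \<in> V0" for c d r
      using that Suc.prems(1)[of c d r] by (simp add: V0_def)
    show "a < n" if "c \<in> V0" "c a \<noteq> 0" for c a
    proof -
      have "a < Suc n" "c n = 0" using that Suc.prems(2)[of c a] by (auto simp: V0_def)
      then show ?thesis using that(2) by (cases "a = n") auto
    qed
  qed
  then obtain S where S: "finite S" "S \<subseteq> V0" "\<And>c. c \<in> V0 \<Longrightarrow> \<exists>e. \<forall>a. c a = (\<Sum>s\<in>S. s a * e s)"
    by blast
  show ?case
  proof (cases "V0 = V")
    case True
    then show ?thesis using S by blast
  next
    case False
    then obtain v where v: "v \<in> V" "v n \<noteq> 0" by (auto simp: V0_def)
    then have "v \<notin> S" using S(2) by (auto simp: V0_def)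
    have "\<exists>e. \<forall>a. c a = (\<Sum>s\<in>insert v S. s a * e s)" if c: "c \<in> V" for c
    proof -
      define r where "r = c n / v n"
      have "(\<lambda>a. c a - r * v a) \<in> V0" using Suc.prems(1)[OF c v(1), of r] v(2) by (simp add: V0_def r_def)
      from S(3)[OF this] obtain e where e: "\<forall>a. c a - r * v a = (\<Sum>s\<in>S. s a * e s)" by blast
      have "c a = (\<Sum>s\<in>insert v S. s a * (if s = v then r else e s))" for a
      proof -
        have "(\<Sum>s\<in>S. s a * (if s = v then r else e s)) = (\<Sum>s\<in>S. s a * e s)"
          using \<open>v \<notin> S\<close> by (intro sum.cong) auto
        then show ?thesis using spec[OF e, of a] S(1) \<open>v \<notin> S\<close> by (simp add: algebra_simps)
      qed
      then show ?thesis by (intro exI[of _ "\<lambda>s. if s = v then r else e s"]) blast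
    qed
    moreover have "insert v S \<subseteq> V" using S(2) v by (auto simp: V0_def)
    ultimately show ?thesis using S(1) by (intro exI[of _ "insert v S"]) blast
  qed
qed

section \<open>Minimal generators and iterated syzygies\<close>

text \<open>An element of \<open>G\<close> is a generator, given by its degree and its coefficient vector.\<close>

definition generates ::
  "(('v::finite \<Rightarrow> int) \<Rightarrow> (nat \<Rightarrow> 'k::field) set) \<Rightarrow> (('v \<Rightarrow> int) \<times> (nat \<Rightarrow> 'k)) set \<Rightarrow> bool" where
  "generates K G \<longleftrightarrow> finite G \<and> (\<forall>g\<in>G. snd g \<in> K (fst g)) \<and>
     (\<forall>\<alpha>. \<forall>c\<in>K \<alpha>. \<exists>e. (\<forall>g. e g \<noteq> 0 \<longrightarrow> g \<in> G \<and> fst g \<le> \<alpha>) \<and> (\<forall>a. c a = (\<Sum>g\<in>G. snd g a * e g)))"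

lemma generatesI:
  assumes "finite G" "\<And>g. g \<in> G \<Longrightarrow> snd g \<in> K (fst g)"
    "\<And>\<alpha> c. c \<in> K \<alpha> \<Longrightarrow> \<exists>e. (\<forall>g. e g \<noteq> 0 \<longrightarrow> g \<in> G \<and> fst g \<le> \<alpha>) \<and> (\<forall>a. c a = (\<Sum>g\<in>G. snd g a * e g))"
  shows "generates K G"
  using assms unfolding generates_def by blast

lemma generatesE:
  assumes "generates K G" "c \<in> K \<alpha>"
  obtains e where "\<forall>g. e g \<noteq> 0 \<longrightarrow> g \<in> G \<and> fst g \<le> \<alpha>" "\<forall>a. c a = (\<Sum>g\<in>G. snd g a * e g)"
proof -
  obtain e where e: "\<forall>g. e g \<noteq> 0 \<longrightarrow> g \<in> G \<and> fst g \<le> \<alpha>" "\<forall>a. c a = (\<Sum>g\<in>G. snd g a * e g)"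
    using assms(1)[unfolded generates_def, THEN conjunct2, THEN conjunct2, THEN spec, THEN bspec, OF assms(2)]
    by (elim exE conjE)
  show thesis by (rule that[OF e])
qed

text \<open>Every nonzero element of degree \<alpha> already lives in one of the finitely many
  degrees of J below \<alpha>, so finite spanning sets in those degrees together generate.\<close>

lemma generates_finite_exists:
  fixes K :: "('v::finite \<Rightarrow> int) \<Rightarrow> (nat \<Rightarrow> 'k::field) set"
  assumes lin: "\<And>\<alpha> c d r. c \<in> K \<alpha> \<Longrightarrow> d \<in> K \<alpha> \<Longrightarrow> (\<lambda>a. c a - r * d a) \<in> K \<alpha>"
    and bound: "\<And>\<alpha> c a. c \<in> K \<alpha> \<Longrightarrow> c a \<noteq> 0 \<Longrightarrow> a < n"
    and J: "finite J" "\<And>\<alpha> c a. c \<in> K \<alpha> \<Longrightarrow> c a \<noteq> 0 \<Longrightarrow> \<exists>\<gamma>\<in>J. \<gamma> \<le> \<alpha> \<and> c \<in> K \<gamma>"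
  shows "\<exists>G. generates K G"
proof -
  have "\<forall>\<gamma>. \<exists>S. finite S \<and> S \<subseteq> K \<gamma> \<and> (\<forall>c\<in>K \<gamma>. \<exists>e. \<forall>a. c a = (\<Sum>s\<in>S. s a * e s))"
  proof
    fix \<gamma> show "\<exists>S. finite S \<and> S \<subseteq> K \<gamma> \<and> (\<forall>c\<in>K \<gamma>. \<exists>e. \<forall>a. c a = (\<Sum>s\<in>S. s a * e s))"
      by (rule finite_spanning_set[of "K \<gamma>" n]) (fact lin bound)+
  qed
  then obtain S where S: "\<And>\<gamma>. finite (S \<gamma>)" "\<And>\<gamma>. S \<gamma> \<subseteq> K \<gamma>"
    "\<And>\<gamma> c. c \<in> K \<gamma> \<Longrightarrow> \<exists>e. \<forall>a. c a = (\<Sum>s\<in>S \<gamma>. s a * e s)" by metis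
  have "generates K (SIGMA \<gamma>:J. S \<gamma>)"
  proof (rule generatesI)
    show fin: "finite (SIGMA \<gamma>:J. S \<gamma>)" using J(1) S(1) by blast
    show "snd g \<in> K (fst g)" if "g \<in> (SIGMA \<gamma>:J. S \<gamma>)" for g
      using that S(2)[of "fst g"] by (cases g) auto
    fix \<alpha> c assume c: "c \<in> K \<alpha>"
    show "\<exists>e. (\<forall>g. e g \<noteq> 0 \<longrightarrow> g \<in> (SIGMA \<gamma>:J. S \<gamma>) \<and> fst g \<le> \<alpha>) \<and>
        (\<forall>a. c a = (\<Sum>g\<in>(SIGMA \<gamma>:J. S \<gamma>). snd g a * e g))"
    proof (cases "\<exists>a. c a \<noteq> 0")
      case False
      then show ?thesis by (intro exI[of _ "\<lambda>_. 0"]) auto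
    next
      case True
      then obtain \<gamma> where \<gamma>: "\<gamma> \<in> J" "\<gamma> \<le> \<alpha>" "c \<in> K \<gamma>" using J(2) c by blast
      from S(3)[OF this(3)] obtain e where e: "\<forall>a. c a = (\<Sum>s\<in>S \<gamma>. s a * e s)" by blast
      define f where "f g = (if fst g = \<gamma> \<and> snd g \<in> S \<gamma> then e (snd g) else 0)" for g
      have "c a = (\<Sum>g\<in>(SIGMA \<gamma>:J. S \<gamma>). snd g a * f g)" for a
      proof -
        have "(\<Sum>g\<in>(SIGMA \<gamma>:J. S \<gamma>). snd g a * f g) = (\<Sum>g\<in>Pair \<gamma> ` S \<gamma>. snd g a * f g)"
          using \<gamma> fin by (intro sum.mono_neutral_right) (auto simp: f_def)
        also have "\<dots> = (\<Sum>s\<in>S \<gamma>. s a * e s)"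
          by (subst sum.reindex) (auto simp: f_def inj_on_def)
        finally show ?thesis using e by simp
      qed
      moreover have "g \<in> (SIGMA \<gamma>:J. S \<gamma>) \<and> fst g \<le> \<alpha>" if "f g \<noteq> 0" for g
        using that \<gamma> by (cases g) (auto simp: f_def split: if_splits)
      ultimately show ?thesis by blast
    qed
  qed
  then show ?thesis by blast
qed

text \<open>A relation of degree \<alpha> with nonzero coefficient at g0 of the same degree
  expresses g0 by the others, and g0 can be discarded. At a generator of smaller degree the relation
  only sees a proper monomial multiple of it.\<close>

lemma minimal_generators_independent:
  assumes G: "generates K G" and min: "\<And>G'. generates K G' \<Longrightarrow> card G \<le> card G'"
    and e: "\<And>g. e g \<noteq> 0 \<Longrightarrow> g \<in> G \<and> fst g \<le> \<alpha>" "\<And>a. (\<Sum>g\<in>G. snd g a * e g) = 0"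
    and g0: "fst g0 = \<alpha>"
  shows "e g0 = 0"
proof (rule ccontr)
  assume nz: "e g0 \<noteq> 0"
  have fin: "finite G" and g0G: "g0 \<in> G" using G nz e by (auto simp: generates_def)
  have "generates K (G - {g0})"
  proof (rule generatesI)
    show "finite (G - {g0})" using fin by simp
    show "snd g \<in> K (fst g)" if "g \<in> G - {g0}" for g using that G by (auto simp: generates_def)
    fix \<beta> c assume c: "c \<in> K \<beta>"
    obtain f where f': "\<forall>g. f g \<noteq> 0 \<longrightarrow> g \<in> G \<and> fst g \<le> \<beta>" "\<forall>a. c a = (\<Sum>g\<in>G. snd g a * f g)"
      by (rule generatesE[of K G, OF G c])
    note f = f'[rule_format]
    define h where "h g = f g - f g0 / e g0 * e g" for g
    have "c a = (\<Sum>g\<in>G - {g0}. snd g a * h g)" for a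
    proof -
      have "(\<Sum>g\<in>G - {g0}. snd g a * h g) = (\<Sum>g\<in>G. snd g a * h g)"
        using sum.remove[OF fin g0G, of "\<lambda>g. snd g a * h g"] nz by (simp add: h_def)
      also have "\<dots> = (\<Sum>g\<in>G. snd g a * f g - f g0 / e g0 * (snd g a * e g))"
        by (intro sum.cong) (auto simp: h_def algebra_simps)
      also have "\<dots> = (\<Sum>g\<in>G. snd g a * f g) - f g0 / e g0 * (\<Sum>g\<in>G. snd g a * e g)"
        by (simp only: sum_subtractf sum_distrib_left)
      finally show ?thesis using f(2) e(2) by simp
    qed
    moreover have "g \<in> G - {g0} \<and> fst g \<le> \<beta>" if "h g \<noteq> 0" for g
    proof -
      have "g \<noteq> g0" using that nz by (auto simp: h_def)
      have "f g \<noteq> 0 \<or> (f g0 \<noteq> 0 \<and> e g \<noteq> 0)" using that by (auto simp: h_def)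
      then show ?thesis
      proof
        assume "f g \<noteq> 0"
        then show ?thesis using f(1)[of g] \<open>g \<noteq> g0\<close> by blast
      next
        assume "f g0 \<noteq> 0 \<and> e g \<noteq> 0"
        then show ?thesis using f(1)[of g0] e(1)[of g] g0 \<open>g \<noteq> g0\<close> by (auto intro: order_trans)
      qed
    qed
    ultimately show "\<exists>e. (\<forall>g. e g \<noteq> 0 \<longrightarrow> g \<in> G - {g0} \<and> fst g \<le> \<beta>) \<and> (\<forall>a. c a = (\<Sum>g\<in>G - {g0}. snd g a * e g))"
      by blast
  qed
  from min[OF this] show False using card_Diff1_less[OF fin g0G] by simp
qed

text \<open>The minimality condition: no relation has a unit coefficient, that is, the syzygies lie
  in the maximal ideal times the free module.\<close>

definition independent_columns :: "('v::finite \<Rightarrow> int) list \<Rightarrow> (nat \<Rightarrow> nat \<Rightarrow> 'k::field) \<Rightarrow> bool" where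
  "independent_columns \<tau> A \<longleftrightarrow> (\<forall>\<alpha>. \<forall>e\<in>strand \<tau> \<alpha>. mat_act (length \<tau>) A e = (\<lambda>_. 0) \<longrightarrow>
     (\<forall>t<length \<tau>. \<tau> ! t = \<alpha> \<longrightarrow> e t = 0))"

definition minimally_generates ::
  "(('v::finite \<Rightarrow> int) \<Rightarrow> (nat \<Rightarrow> 'k::field) set) \<Rightarrow> ('v \<Rightarrow> int) list \<Rightarrow> (nat \<Rightarrow> nat \<Rightarrow> 'k) \<Rightarrow> bool" where
  "minimally_generates K \<tau> A \<longleftrightarrow> (\<forall>a t. A a t \<noteq> 0 \<longrightarrow> t < length \<tau>) \<and>
     (\<forall>t<length \<tau>. (\<lambda>a. A a t) \<in> K (\<tau> ! t)) \<and>
     (\<forall>\<alpha>. \<forall>c\<in>K \<alpha>. \<exists>e\<in>strand \<tau> \<alpha>. mat_act (length \<tau>) A e = c) \<and>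
     independent_columns \<tau> A"

lemma minimal_generating_matrix:
  fixes K :: "('v::finite \<Rightarrow> int) \<Rightarrow> (nat \<Rightarrow> 'k::field) set"
  assumes lin: "\<And>\<alpha> c d r. c \<in> K \<alpha> \<Longrightarrow> d \<in> K \<alpha> \<Longrightarrow> (\<lambda>a. c a - r * d a) \<in> K \<alpha>"
    and bound: "\<And>\<alpha> c a. c \<in> K \<alpha> \<Longrightarrow> c a \<noteq> 0 \<Longrightarrow> a < n"
    and J: "finite J" "\<And>\<alpha> c a. c \<in> K \<alpha> \<Longrightarrow> c a \<noteq> 0 \<Longrightarrow> \<exists>\<gamma>\<in>J. \<gamma> \<le> \<alpha> \<and> c \<in> K \<gamma>"
  shows "\<exists>\<tau> A. minimally_generates K \<tau> A"
proof -
  have "\<exists>G. generates K G" by (rule generates_finite_exists[of K n J]) (fact lin bound J)+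
  then obtain G\<^sub>0 where G0: "generates K G\<^sub>0" ..
  define G where "G = arg_min card (generates K)"
  have G: "generates K G" unfolding G_def by (rule arg_min_natI[of "generates K", OF G0])
  have min: "card G \<le> card G'" if "generates K G'" for G'
    unfolding G_def by (rule arg_min_nat_le[of "generates K", OF that])
  have "finite G" using G by (simp add: generates_def)
  then obtain gs where gs: "set gs = G" "distinct gs" using finite_distinct_list by blast
  define A where "A a t = (if t < length gs then snd (gs ! t) a else 0)" for a t
  define \<tau> where "\<tau> = map fst gs"
  have bij: "bij_betw ((!) gs) {..<length gs} G" using bij_betw_nth[OF gs(2) refl gs(1)[symmetric]] .
  have app: "mat_act (length \<tau>) A (\<lambda>t. if t < length gs then e (gs ! t) else 0) a = (\<Sum>g\<in>G. snd g a * e g)" for e a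
  proof -
    have "mat_act (length \<tau>) A (\<lambda>t. if t < length gs then e (gs ! t) else 0) a = (\<Sum>t<length gs. snd (gs ! t) a * e (gs ! t))"
      unfolding mat_act_def \<tau>_def by (intro sum.cong) (auto simp: A_def)
    then show ?thesis using sum.reindex_bij_betw[OF bij, of "\<lambda>g. snd g a * e g"] by simp
  qed
  have "minimally_generates K \<tau> A"
    unfolding minimally_generates_def
  proof (intro conjI allI impI ballI)
    show "t < length \<tau>" if "A a t \<noteq> 0" for a t using that by (auto simp: A_def \<tau>_def split: if_splits)
    show "(\<lambda>a. A a t) \<in> K (\<tau> ! t)" if "t < length \<tau>" for t
      using that G nth_mem[of t gs] gs(1) by (auto simp: A_def \<tau>_def generates_def)
    show "\<exists>e\<in>strand \<tau> \<alpha>. mat_act (length \<tau>) A e = c" if cK: "c \<in> K \<alpha>" for \<alpha> c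
    proof -
      obtain e where e': "\<forall>g. e g \<noteq> 0 \<longrightarrow> g \<in> G \<and> fst g \<le> \<alpha>" "\<forall>a. c a = (\<Sum>g\<in>G. snd g a * e g)"
        by (rule generatesE[of K G, OF G cK])
      note e = e'[rule_format]
      let ?e = "\<lambda>t. if t < length gs then e (gs ! t) else 0"
      have "?e \<in> strand \<tau> \<alpha>"
        by (rule strandI) (use e(1) in \<open>auto simp: \<tau>_def split: if_splits\<close>)
      moreover have "mat_act (length \<tau>) A ?e = c" by (rule ext) (simp only: app e(2))
      ultimately show ?thesis by blast
    qed
    show "independent_columns \<tau> A"
      unfolding independent_columns_def
    proof (intro allI ballI impI)
      fix \<alpha> e t assume e: "e \<in> strand \<tau> \<alpha>" "mat_act (length \<tau>) A e = (\<lambda>_. 0)" and t: "t < length \<tau>" "\<tau> ! t = \<alpha>"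
      define idx where "idx = the_inv_into {..<length gs} ((!) gs)"
      have idx: "idx (gs ! s) = s" if "s < length gs" for s
        unfolding idx_def using bij that by (intro the_inv_into_f_f) (auto simp: bij_betw_def)
      define f where "f g = (if g \<in> G then e (idx g) else 0)" for g
      have fe: "(\<lambda>s. if s < length gs then f (gs ! s) else 0) = e"
      proof
        fix s show "(if s < length gs then f (gs ! s) else 0) = e s"
          using strandD[OF e(1), of s] nth_mem[of s gs] gs(1) idx[of s] by (auto simp: f_def \<tau>_def)
      qed
      have "f (gs ! t) = 0"
      proof (rule minimal_generators_independent[OF G min])
        show "g \<in> G \<and> fst g \<le> \<alpha>" if nz: "f g \<noteq> 0" for g
        proof -
          have "g \<in> G" using nz by (auto simp: f_def split: if_splits)
          then obtain s where s: "s < length gs" "g = gs ! s" using gs(1) by (auto simp: in_set_conv_nth)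
          then have "e s \<noteq> 0" using nz idx by (auto simp: f_def split: if_splits)
          then show ?thesis using strandD[OF e(1), of s] s \<open>g \<in> G\<close> by (auto simp: \<tau>_def)
        qed
        show "(\<Sum>g\<in>G. snd g a * f g) = 0" for a using app[of f a] e(2) fe by simp
        show "fst (gs ! t) = \<alpha>" using t by (simp add: \<tau>_def)
      qed
      then show "e t = 0" using t gs(1) idx[of t] by (auto simp: f_def \<tau>_def)
    qed
  qed
  then show ?thesis by blast
qed

text \<open>\<open>independent_columns\<close> appears on both sides so that the construction
  iterates: for A it makes the entries of B strictly degree-raising, for B it feeds the next
  step.\<close>

lemma syzygy_matrix:
  fixes A :: "nat \<Rightarrow> nat \<Rightarrow> 'k::field" and \<tau> :: "('v::finite \<Rightarrow> int) list"
  assumes ind: "independent_columns \<tau> A"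
  shows "\<exists>\<upsilon> B. (\<forall>b t. B b t \<noteq> 0 \<longrightarrow> b < length \<tau> \<and> t < length \<upsilon> \<and> \<tau> ! b < \<upsilon> ! t) \<and>
    (\<forall>\<alpha>. \<forall>c\<in>strand \<tau> \<alpha>. mat_act (length \<tau>) A c = (\<lambda>_. 0) \<longleftrightarrow>
      (\<exists>e\<in>strand \<upsilon> \<alpha>. mat_act (length \<upsilon>) B e = c)) \<and>
    independent_columns \<upsilon> B"
proof -
  define K where "K \<alpha> = {c \<in> strand \<tau> \<alpha>. mat_act (length \<tau>) A c = (\<lambda>_. 0)}" for \<alpha>
  \<comment> \<open>\<open>Max\<close> is unspecified on the empty set, but the support of a nonzero
    syzygy is never empty.\<close>
  define join where "join S = (\<lambda>x. Max ((\<lambda>b. (\<tau> ! b) x) ` S))" for S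
  have K1: "(\<lambda>a. c a - r * d a) \<in> K \<alpha>" if "c \<in> K \<alpha>" "d \<in> K \<alpha>" for \<alpha> c d r
    using that strand_diff[OF _ strand_scale, of c \<tau> \<alpha> d r] by (simp add: K_def mat_act_diff mat_act_scale)
  have K2: "a < length \<tau>" if "c \<in> K \<alpha>" "c a \<noteq> 0" for \<alpha> c a
    using that strandD by (auto simp: K_def)
  have K3: "finite (join ` Pow {..<length \<tau>})" by simp
  have K4: "\<exists>\<gamma>\<in>join ` Pow {..<length \<tau>}. \<gamma> \<le> \<alpha> \<and> c \<in> K \<gamma>" if c: "c \<in> K \<alpha>" "c a \<noteq> 0" for \<alpha> c a
  proof -
    define S where "S = {b. c b \<noteq> 0}"
    have st: "c \<in> strand \<tau> \<alpha>" using c(1) by (simp add: K_def)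
    have S: "S \<subseteq> {..<length \<tau>}" "finite S" "S \<noteq> {}"
      using strandD[OF st] c(2) finite_subset[of S "{..<length \<tau>}"] by (auto simp: S_def)
    have "join S \<le> \<alpha>" unfolding join_def le_fun_def
    proof
      fix x
      have "(\<tau> ! b) x \<le> \<alpha> x" if "b \<in> S" for b
        using strandD[OF st, of b] that by (auto simp: S_def le_fun_def)
      then show "Max ((\<lambda>b. (\<tau> ! b) x) ` S) \<le> \<alpha> x" using S by simp
    qed
    moreover have "c \<in> strand \<tau> (join S)"
    proof (rule strandI)
      fix b assume b: "c b \<noteq> 0"
      then have "b \<in> S" by (simp add: S_def)
      then have "\<tau> ! b \<le> join S" using S(2) by (auto simp: join_def le_fun_def)
      with strandD[OF st b] show "b < length \<tau> \<and> \<tau> ! b \<le> join S" by simp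
    qed
    then have "c \<in> K (join S)" using c(1) by (simp add: K_def)
    ultimately show ?thesis using S(1) by blast
  qed
  have "\<exists>\<upsilon> B. minimally_generates K \<upsilon> B"
    by (rule minimal_generating_matrix[of K "length \<tau>" "join ` Pow {..<length \<tau>}"]) (fact K1 K2 K3 K4)+
  then obtain \<upsilon> B where m: "minimally_generates K \<upsilon> B" by blast
  have B: "B a t \<noteq> 0 \<Longrightarrow> t < length \<upsilon>"
    "t < length \<upsilon> \<Longrightarrow> (\<lambda>a. B a t) \<in> K (\<upsilon> ! t)"
    "c \<in> K \<alpha> \<Longrightarrow> \<exists>e\<in>strand \<upsilon> \<alpha>. mat_act (length \<upsilon>) B e = c"
    "independent_columns \<upsilon> B" for a t \<alpha> c
    using m[unfolded minimally_generates_def] by auto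
  show ?thesis
  proof (intro exI[of _ \<upsilon>] exI[of _ B] conjI allI impI ballI)
    fix b t assume nz: "B b t \<noteq> 0"
    have t: "t < length \<upsilon>" by (rule B(1)[OF nz])
    have c: "(\<lambda>a. B a t) \<in> strand \<tau> (\<upsilon> ! t)" "mat_act (length \<tau>) A (\<lambda>a. B a t) = (\<lambda>_. 0)"
      using B(2)[OF t] by (auto simp: K_def)
    have b: "b < length \<tau>" "\<tau> ! b \<le> \<upsilon> ! t" using strandD[OF c(1) nz] by auto
    have "\<tau> ! b \<noteq> \<upsilon> ! t" using ind c b nz unfolding independent_columns_def by blast
    with b t show "b < length \<tau>" "t < length \<upsilon>" "\<tau> ! b < \<upsilon> ! t" by simp_all
  next
    fix \<alpha> and c :: "nat \<Rightarrow> 'k" assume c: "c \<in> strand \<tau> \<alpha>"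
    show "mat_act (length \<tau>) A c = (\<lambda>_. 0) \<longleftrightarrow> (\<exists>e\<in>strand \<upsilon> \<alpha>. mat_act (length \<upsilon>) B e = c)"
    proof
      assume "mat_act (length \<tau>) A c = (\<lambda>_. 0)"
      with c show "\<exists>e\<in>strand \<upsilon> \<alpha>. mat_act (length \<upsilon>) B e = c" by (intro B(3)) (simp add: K_def)
    next
      assume "\<exists>e\<in>strand \<upsilon> \<alpha>. mat_act (length \<upsilon>) B e = c"
      then obtain e where e: "mat_act (length \<upsilon>) B e = c" by blast
      have "c = (\<lambda>a. \<Sum>t<length \<upsilon>. e t * B a t)" unfolding e[symmetric] by (simp add: mat_act_def mult.commute)
      moreover have "mat_act (length \<tau>) A (\<lambda>a. B a t) a = 0" if "t < length \<upsilon>" for t a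
        using B(2)[OF that] by (simp add: K_def)
      ultimately show "mat_act (length \<tau>) A c = (\<lambda>_. 0)" by (simp add: mat_act_sum mat_act_scale)
    qed
  qed (rule B(4))
qed

text \<open>The first matrix generates the ideal as a submodule of R; from there syzygies are
  iterated by dependent choice. That \<open>P\<close> fails at 0 makes the entries of the first
  matrix strictly degree-raising too.\<close>

lemma strand_resolution_exists:
  fixes P :: "('v::finite \<Rightarrow> int) \<Rightarrow> bool"
  assumes up: "\<And>\<alpha> \<beta>. P \<alpha> \<Longrightarrow> \<alpha> \<le> \<beta> \<Longrightarrow> P \<beta>" and nonneg: "\<And>\<alpha>. P \<alpha> \<Longrightarrow> (\<lambda>_. 0) \<le> \<alpha>" and proper: "\<not> P (\<lambda>_. 0)"
    and J: "finite J" "\<And>\<alpha>. P \<alpha> \<Longrightarrow> \<exists>\<gamma>\<in>J. \<gamma> \<le> \<alpha> \<and> P \<gamma>"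
  shows "\<exists>F (L :: nat \<Rightarrow> nat \<Rightarrow> nat \<Rightarrow> 'k::field). strand_resolution P F L"
proof -
  let ?O = "[\<lambda>_. 0] :: ('v \<Rightarrow> int) list"
  define K :: "('v \<Rightarrow> int) \<Rightarrow> (nat \<Rightarrow> 'k) set" where "K \<alpha> = {c \<in> strand ?O \<alpha>. c 0 \<noteq> 0 \<longrightarrow> P \<alpha>}" for \<alpha>
  have K1: "(\<lambda>a. c a - r * d a) \<in> K \<alpha>" if "c \<in> K \<alpha>" "d \<in> K \<alpha>" for \<alpha> c d r
    using that strand_diff[OF _ strand_scale, of c ?O \<alpha> d r] by (auto simp: K_def)
  have K2: "a < 1" if "c \<in> K \<alpha>" "c a \<noteq> 0" for \<alpha> c a
    using that strandD[of c ?O \<alpha> a] by (auto simp: K_def)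
  have K4: "\<exists>\<gamma>\<in>J. \<gamma> \<le> \<alpha> \<and> c \<in> K \<gamma>" if c: "c \<in> K \<alpha>" "c a \<noteq> 0" for \<alpha> c a
  proof -
    have "P \<alpha>" using K2[OF c] c by (auto simp: K_def)
    then obtain \<gamma> where \<gamma>: "\<gamma> \<in> J" "\<gamma> \<le> \<alpha>" "P \<gamma>" using J(2) by blast
    have "c \<in> strand ?O \<gamma>"
      by (rule strandI) (use K2[OF c(1)] nonneg[OF \<gamma>(3)] in fastforce)
    then have "c \<in> K \<gamma>" using \<gamma>(3) by (simp add: K_def)
    with \<gamma> show ?thesis by blast
  qed
  have "\<exists>\<tau> A. minimally_generates K \<tau> A"
    by (rule minimal_generating_matrix[of K 1 J]) (fact K1 K2 J(1) K4)+
  then obtain \<tau> A where m: "minimally_generates K \<tau> A" by blast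
  have A: "A a t \<noteq> 0 \<Longrightarrow> t < length \<tau>"
    "t < length \<tau> \<Longrightarrow> (\<lambda>a. A a t) \<in> K (\<tau> ! t)"
    "c \<in> K \<alpha> \<Longrightarrow> \<exists>e\<in>strand \<tau> \<alpha>. mat_act (length \<tau>) A e = c"
    "independent_columns \<tau> A" for a t \<alpha> c
    using m[unfolded minimally_generates_def] by auto
  have A0: "a = 0 \<and> t < length \<tau> \<and> P (\<tau> ! t)" if nz: "A a t \<noteq> 0" for a t
  proof -
    have t: "t < length \<tau>" by (rule A(1)[OF nz])
    then show ?thesis using A(2)[OF t] K2[OF A(2)[OF t] nz] nz by (auto simp: K_def)
  qed
  \<comment> \<open>A state holds the target degrees, the source degrees and the matrix of one
    differential; consecutive states share a list of degrees.\<close>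
  define ok where "ok s \<longleftrightarrow> (case s of (\<sigma>, \<tau>, A :: nat \<Rightarrow> nat \<Rightarrow> 'k) \<Rightarrow>
      (\<forall>a t. A a t \<noteq> 0 \<longrightarrow> a < length \<sigma> \<and> t < length \<tau> \<and> \<sigma> ! a < \<tau> ! t) \<and> independent_columns \<tau> A)"
    for s :: "('v \<Rightarrow> int) list \<times> ('v \<Rightarrow> int) list \<times> (nat \<Rightarrow> nat \<Rightarrow> 'k)"
  define next_to where "next_to s s' \<longleftrightarrow> (case (s, s') of ((\<sigma>, \<tau>, A :: nat \<Rightarrow> nat \<Rightarrow> 'k), (\<tau>', \<upsilon>, B :: nat \<Rightarrow> nat \<Rightarrow> 'k)) \<Rightarrow>
      \<tau>' = \<tau> \<and> (\<forall>\<alpha>. \<forall>c\<in>strand \<tau> \<alpha>. mat_act (length \<tau>) A c = (\<lambda>_. 0) \<longleftrightarrow> (\<exists>e\<in>strand \<upsilon> \<alpha>. mat_act (length \<upsilon>) B e = c)))"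
    for s s' :: "('v \<Rightarrow> int) list \<times> ('v \<Rightarrow> int) list \<times> (nat \<Rightarrow> nat \<Rightarrow> 'k)"
  have "a < length ?O \<and> t < length \<tau> \<and> ?O ! a < \<tau> ! t" if nz: "A a t \<noteq> 0" for a t
    using A0[OF nz] nonneg[of "\<tau> ! t"] proper by (auto simp: order.strict_iff_order)
  then have start: "ok (?O, \<tau>, A)" using A(4) by (auto simp: ok_def)
  have step: "\<exists>s'. ok s' \<and> next_to s s'" if "ok s" for s
  proof -
    obtain \<sigma> \<tau> A where s: "s = (\<sigma>, \<tau>, A)" by (cases s)
    with that have "independent_columns \<tau> A" by (simp add: ok_def)
    from syzygy_matrix[OF this] obtain \<upsilon> B where
      B: "\<forall>b t. B b t \<noteq> 0 \<longrightarrow> b < length \<tau> \<and> t < length \<upsilon> \<and> \<tau> ! b < \<upsilon> ! t"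
      "\<forall>\<alpha>. \<forall>c\<in>strand \<tau> \<alpha>. mat_act (length \<tau>) A c = (\<lambda>_. 0) \<longleftrightarrow> (\<exists>e\<in>strand \<upsilon> \<alpha>. mat_act (length \<upsilon>) B e = c)"
      "independent_columns \<upsilon> B" by (elim exE conjE)
    have "ok (\<tau>, \<upsilon>, B)" unfolding ok_def prod.case by (intro conjI B)
    moreover have "next_to s (\<tau>, \<upsilon>, B)" unfolding next_to_def s prod.case by (intro conjI refl B)
    ultimately show ?thesis by blast
  qed
  have "\<exists>f. \<forall>n. (ok (f n) \<and> (n = 0 \<longrightarrow> f n = (?O, \<tau>, A))) \<and> next_to (f n) (f (Suc n))"
  proof (rule dependent_nat_choice)
    show "\<exists>s. ok s \<and> ((0::nat) = 0 \<longrightarrow> s = (?O, \<tau>, A))" using start by blast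
    fix s and n :: nat assume "ok s \<and> (n = 0 \<longrightarrow> s = (?O, \<tau>, A))"
    then have "ok s" ..
    from step[OF this] show "\<exists>s'. (ok s' \<and> (Suc n = 0 \<longrightarrow> s' = (?O, \<tau>, A))) \<and> next_to s s'" by auto
  qed
  then obtain f where f: "\<And>n. ok (f n)" "f 0 = (?O, \<tau>, A)" "\<And>n. next_to (f n) (f (Suc n))" by blast
  define F where "F n = fst (f n)" for n
  define L where "L n = snd (snd (f n))" for n
  have F_Suc: "fst (snd (f n)) = F (Suc n)" for n
    using f(3)[of n] by (auto simp: next_to_def F_def split: prod.splits)
  have f_eq: "f n = (F n, F (Suc n), L n)" for n using F_Suc[of n] by (simp add: F_def L_def prod_eq_iff)
  have F0: "F 0 = ?O" "F 1 = \<tau>" "L 0 = A" using f(2) F_Suc[of 0] by (auto simp: F_def L_def)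
  have "strand_resolution P F L"
  proof
    show "F 0 = ?O" by (rule F0)
    show "a < length (F i) \<and> b < length (F (Suc i)) \<and> F i ! a < F (Suc i) ! b" if "L i a b \<noteq> 0" for i a b
      using f(1)[of i] that unfolding f_eq by (auto simp: ok_def)
    show "mat_act (length (F (Suc i))) (L i) c = (\<lambda>_. 0) \<longleftrightarrow>
        (\<exists>e\<in>strand (F (Suc (Suc i))) \<alpha>. mat_act (length (F (Suc (Suc i)))) (L (Suc i)) e = c)"
      if "c \<in> strand (F (Suc i)) \<alpha>" for i c \<alpha>
      using f(3)[of i] that unfolding f_eq by (auto simp: next_to_def)
    show "P \<alpha> \<longleftrightarrow> (\<exists>e\<in>strand (F 1) \<alpha>. mat_act (length (F 1)) (L 0) e = std_unit 0)" for \<alpha>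
    proof
      assume "P \<alpha>"
      then have "std_unit 0 \<in> K \<alpha>" using nonneg by (auto simp: K_def std_unit_def strand_def)
      then show "\<exists>e\<in>strand (F 1) \<alpha>. mat_act (length (F 1)) (L 0) e = std_unit 0" unfolding F0 by (rule A(3))
    next
      assume "\<exists>e\<in>strand (F 1) \<alpha>. mat_act (length (F 1)) (L 0) e = std_unit 0"
      then obtain e where e: "e \<in> strand \<tau> \<alpha>" "mat_act (length \<tau>) A e = std_unit 0" unfolding F0 by blast
      then have "mat_act (length \<tau>) A e 0 \<noteq> 0" by (simp add: std_unit_def)
      then obtain t where "A 0 t \<noteq> 0" "e t \<noteq> 0" using mat_act_nonzero by blast
      then show "P \<alpha>" using A0 strandD[OF e(1)] up by blast
    qed
  qed
  then show ?thesis by blast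
qed

section \<open>Homogeneous components over the polynomial ring\<close>

definition exponent :: "('v::finite \<Rightarrow> int) \<Rightarrow> 'v \<Rightarrow>\<^sub>0 nat" where
  "exponent \<alpha> = Abs_poly_mapping (\<lambda>x. nat (\<alpha> x))"

definition degree_of :: "('v::finite \<Rightarrow>\<^sub>0 nat) \<Rightarrow> 'v \<Rightarrow> int" where
  "degree_of m = (\<lambda>x. int (Poly_Mapping.lookup m x))"

lemma lookup_exponent: "Poly_Mapping.lookup (exponent \<alpha>) x = nat (\<alpha> x)"
  by (simp add: exponent_def)

lemma exponent_degree_of [simp]: "exponent (degree_of m) = m"
  by (rule poly_mapping_eqI) (simp add: lookup_exponent degree_of_def)

lemma degree_of_exponent: "(\<lambda>_. 0) \<le> \<alpha> \<Longrightarrow> degree_of (exponent \<alpha>) = \<alpha>"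
  by (rule ext) (simp add: lookup_exponent degree_of_def le_fun_def)

lemma degree_of_nonneg: "(\<lambda>_. 0) \<le> degree_of m"
  by (simp add: degree_of_def le_fun_def)

lemma exponent_add: "(\<lambda>_. 0) \<le> \<alpha> \<Longrightarrow> (\<lambda>_. 0) \<le> \<beta> \<Longrightarrow> exponent (\<lambda>x. \<alpha> x + \<beta> x) = exponent \<alpha> + exponent \<beta>"
  by (rule poly_mapping_eqI) (simp add: lookup_exponent lookup_add le_fun_def nat_add_distrib)

lemma poly_mapping_eq_sum_single: "q = (\<Sum>k\<in>Poly_Mapping.keys q. Poly_Mapping.single k (Poly_Mapping.lookup q k))"
  by (rule poly_mapping_eqI) (simp add: lookup_sum lookup_single when_def sum.delta in_keys_iff)

lemma lookup_single_times:
  fixes q :: "('v, 'k::field) mpoly"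
  shows "Poly_Mapping.lookup (Poly_Mapping.single m c * q) k =
    (\<Sum>l\<in>Poly_Mapping.keys q. if k = m + l then c * Poly_Mapping.lookup q l else 0)"
proof -
  have "Poly_Mapping.single m c * q =
      (\<Sum>l\<in>Poly_Mapping.keys q. Poly_Mapping.single (m + l) (c * Poly_Mapping.lookup q l))"
    by (subst (1) poly_mapping_eq_sum_single[of q]) (simp add: sum_distrib_left mult_single)
  then have "Poly_Mapping.lookup (Poly_Mapping.single m c * q) k =
      (\<Sum>l\<in>Poly_Mapping.keys q. Poly_Mapping.lookup (Poly_Mapping.single (m + l) (c * Poly_Mapping.lookup q l)) k)"
    by (simp only: lookup_sum)
  also have "\<dots> = (\<Sum>l\<in>Poly_Mapping.keys q. if k = m + l then c * Poly_Mapping.lookup q l else 0)"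
    by (intro sum.cong) (auto simp: lookup_single when_def)
  finally show ?thesis .
qed

lemma lookup_single_times_add:
  fixes q :: "('v, 'k::field) mpoly"
  shows "Poly_Mapping.lookup (Poly_Mapping.single m c * q) (m + k) = c * Poly_Mapping.lookup q k"
  by (simp add: lookup_single_times in_keys_iff)

lemma lookup_single_times_0:
  fixes q :: "('v, 'k::field) mpoly"
  assumes "\<And>k'. k \<noteq> m + k'"
  shows "Poly_Mapping.lookup (Poly_Mapping.single m c * q) k = 0"
  by (simp add: lookup_single_times assms)

text \<open>\<open>exponent\<close> truncates negative entries to 0, so without the guard a degree
  with negative entries would pick up the coefficient of another monomial.\<close>

definition hcoeff :: "('v::finite \<Rightarrow> int) \<Rightarrow> ('v, 'k::field) mpoly \<Rightarrow> 'k" where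
  "hcoeff \<delta> p = (if (\<lambda>_. 0) \<le> \<delta> then Poly_Mapping.lookup p (exponent \<delta>) else 0)"

definition graded_term :: "('v::finite \<Rightarrow> int) \<Rightarrow> 'k::field \<Rightarrow> ('v, 'k) mpoly" where
  "graded_term \<delta> c = (if (\<lambda>_. 0) \<le> \<delta> then Poly_Mapping.single (exponent \<delta>) c else 0)"

lemma hcoeff_degree_of: "hcoeff (degree_of m) p = Poly_Mapping.lookup p m"
  by (simp add: hcoeff_def degree_of_nonneg)

lemma hcoeff_eqI: "(\<And>\<delta>. hcoeff \<delta> p = hcoeff \<delta> q) \<Longrightarrow> p = q"
  by (rule poly_mapping_eqI) (metis hcoeff_degree_of)

lemma hcoeff_0 [simp]: "hcoeff \<delta> 0 = 0"
  by (simp add: hcoeff_def)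

lemma hcoeff_add: "hcoeff \<delta> (p + q) = hcoeff \<delta> p + hcoeff \<delta> q"
  by (simp add: hcoeff_def lookup_add)

lemma hcoeff_sum: "hcoeff \<delta> (\<Sum>i\<in>I. p i) = (\<Sum>i\<in>I. hcoeff \<delta> (p i))"
  by (induction I rule: infinite_finite_induct) (auto simp: hcoeff_add)

lemma exponent_inject: "(\<lambda>_. 0) \<le> \<alpha> \<Longrightarrow> (\<lambda>_. 0) \<le> \<beta> \<Longrightarrow> exponent \<alpha> = exponent \<beta> \<longleftrightarrow> \<alpha> = \<beta>"
  by (metis degree_of_exponent)

lemma hcoeff_graded_term: "hcoeff \<epsilon> (graded_term \<delta> c) = (if \<epsilon> = \<delta> \<and> (\<lambda>_. 0) \<le> \<delta> then c else 0)"
  by (auto simp: hcoeff_def graded_term_def lookup_single when_def exponent_inject)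

lemma homogeneous_graded_term: "homogeneous \<delta> (graded_term \<delta> c)"
  by (auto simp: homogeneous_def graded_term_def lookup_exponent le_fun_def split: if_splits)

text \<open>Each degree carries at most one monomial, so a homogeneous polynomial is a single term.
  This is what reduces graded matrices to matrices of scalars.\<close>

lemma homogeneous_eq_graded_term:
  assumes "homogeneous \<delta> p" shows "p = graded_term \<delta> (hcoeff \<delta> p)"
proof (rule poly_mapping_eqI)
  fix m
  have *: "degree_of m = \<delta>" if "Poly_Mapping.lookup p m \<noteq> 0"
    using assms that by (auto simp: homogeneous_def degree_of_def in_keys_iff)
  show "Poly_Mapping.lookup p m = Poly_Mapping.lookup (graded_term \<delta> (hcoeff \<delta> p)) m"
    using * degree_of_nonneg[of m] degree_of_exponent[of \<delta>]
    by (cases "degree_of m = \<delta>") (auto simp: graded_term_def hcoeff_def lookup_single when_def)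
qed

lemma hcoeff_graded_term_times:
  "hcoeff \<epsilon> (graded_term \<delta> c * q) = (if (\<lambda>_. 0) \<le> \<delta> then c * hcoeff (\<lambda>x. \<epsilon> x - \<delta> x) q else 0)"
proof (cases "(\<lambda>_. 0) \<le> \<delta> \<and> (\<lambda>_. 0) \<le> \<epsilon>")
  case False
  have "\<not> (\<lambda>_. 0) \<le> (\<lambda>x. \<epsilon> x - \<delta> x)" if "(\<lambda>_. 0) \<le> \<delta>"
    using False that unfolding le_fun_def by (meson diff_ge_0_iff_ge order_trans)
  with False show ?thesis by (auto simp: graded_term_def hcoeff_def)
next
  case True
  then have d: "(\<lambda>_. 0) \<le> \<delta>" and e: "(\<lambda>_. 0) \<le> \<epsilon>" by auto
  let ?\<eta> = "\<lambda>x. \<epsilon> x - \<delta> x"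
  show ?thesis
  proof (cases "(\<lambda>_. 0) \<le> ?\<eta>")
    case True
    have "exponent \<epsilon> = exponent \<delta> + exponent ?\<eta>" using exponent_add[OF d True] by simp
    then show ?thesis using d e True by (simp add: graded_term_def hcoeff_def lookup_single_times_add)
  next
    case False
    have "exponent \<epsilon> \<noteq> exponent \<delta> + k" for k
    proof
      assume *: "exponent \<epsilon> = exponent \<delta> + k"
      have "\<epsilon> x = \<delta> x + int (Poly_Mapping.lookup k x)" for x
        using arg_cong[OF *, of "\<lambda>m. Poly_Mapping.lookup m x"] d e
        by (simp add: lookup_exponent lookup_add le_fun_def) (metis int_nat_eq of_nat_add)
      then show False using False by (simp add: le_fun_def)
    qed
    then show ?thesis using d e False by (simp add: graded_term_def hcoeff_def lookup_single_times_0)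
  qed
qed

lemma hcoeff_homogeneous_times:
  assumes "homogeneous \<delta> p" shows "hcoeff \<epsilon> (p * q) = hcoeff \<delta> p * hcoeff (\<lambda>x. \<epsilon> x - \<delta> x) q"
proof -
  have "hcoeff \<epsilon> (p * q) = hcoeff \<epsilon> (graded_term \<delta> (hcoeff \<delta> p) * q)" using homogeneous_eq_graded_term[OF assms] by simp
  also have "\<dots> = hcoeff \<delta> p * hcoeff (\<lambda>x. \<epsilon> x - \<delta> x) q" by (simp add: hcoeff_graded_term_times) (simp add: hcoeff_def)
  finally show ?thesis .
qed

section \<open>Homogeneous components of vectors and graded matrices\<close>

definition to_vec :: "('v::finite \<Rightarrow> int) list \<Rightarrow> ('v \<Rightarrow> int) \<Rightarrow> (nat \<Rightarrow> 'k::field) \<Rightarrow> ('v, 'k) mpoly vec" where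
  "to_vec \<sigma> \<alpha> c = vec (length \<sigma>) (\<lambda>b. graded_term (\<lambda>x. \<alpha> x - (\<sigma> ! b) x) (c b))"

definition component :: "('v::finite \<Rightarrow> int) list \<Rightarrow> ('v \<Rightarrow> int) \<Rightarrow> ('v, 'k::field) mpoly vec \<Rightarrow> nat \<Rightarrow> 'k" where
  "component \<sigma> \<alpha> w = (\<lambda>b. if b < length \<sigma> then hcoeff (\<lambda>x. \<alpha> x - (\<sigma> ! b) x) (w $ b) else 0)"

lemma component_strand: "component \<sigma> \<alpha> w \<in> strand \<sigma> \<alpha>"
  by (rule strandI) (auto simp: component_def hcoeff_def le_fun_def split: if_splits)

lemma to_vec_carrier [simp]: "to_vec \<sigma> \<alpha> c \<in> carrier_vec (length \<sigma>)"
  by (simp add: to_vec_def)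

lemma component_to_vec:
  assumes "c \<in> strand \<sigma> \<alpha>"
  shows "component \<sigma> \<beta> (to_vec \<sigma> \<alpha> c) = (if \<beta> = \<alpha> then c else (\<lambda>_. 0))"
proof
  fix b
  show "component \<sigma> \<beta> (to_vec \<sigma> \<alpha> c) b = (if \<beta> = \<alpha> then c else (\<lambda>_. 0)) b"
    using strandD[OF assms, of b]
    by (cases "b < length \<sigma>") (auto simp: component_def to_vec_def hcoeff_graded_term fun_eq_iff le_fun_def)
qed

lemma component_eqI:
  assumes "v \<in> carrier_vec (length \<sigma>)" "w \<in> carrier_vec (length \<sigma>)"
    "\<And>\<alpha>. component \<sigma> \<alpha> v = component \<sigma> \<alpha> w"
  shows "v = w"
proof (rule eq_vecI)
  fix b assume b: "b < dim_vec w"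
  show "v $ b = w $ b"
  proof (rule hcoeff_eqI)
    fix \<delta>
    show "hcoeff \<delta> (v $ b) = hcoeff \<delta> (w $ b)"
      using fun_cong[OF assms(3)[of "\<lambda>x. \<delta> x + (\<sigma> ! b) x"], of b] b assms(2)
      by (simp add: component_def)
  qed
qed (use assms in auto)

lemma component_0 [simp]: "component \<sigma> \<alpha> (0\<^sub>v (length \<sigma>)) = (\<lambda>_. 0)"
  by (auto simp: component_def fun_eq_iff)

definition scalars :: "('v::finite \<Rightarrow> int) list \<Rightarrow> ('v \<Rightarrow> int) list \<Rightarrow> ('v, 'k::field) mpoly mat \<Rightarrow> nat \<Rightarrow> nat \<Rightarrow> 'k" where
  "scalars \<sigma> \<rho> D a b = (if a < length \<rho> \<and> b < length \<sigma> then hcoeff (\<lambda>x. (\<sigma> ! b) x - (\<rho> ! a) x) (D $$ (a, b)) else 0)"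

text \<open>Multiplying by a homogeneous entry shifts degrees by a fixed amount, so the
  \<alpha>-component of the product sees only that of w. All strands therefore share one scalar
  matrix.\<close>

lemma component_mult:
  assumes D: "graded_map \<sigma> \<rho> D" and w: "w \<in> carrier_vec (length \<sigma>)"
  shows "component \<rho> \<alpha> (D *\<^sub>v w) = mat_act (length \<sigma>) (scalars \<sigma> \<rho> D) (component \<sigma> \<alpha> w)"
proof
  fix a
  have car: "D \<in> carrier_mat (length \<rho>) (length \<sigma>)" using D by (simp add: graded_map_def)
  show "component \<rho> \<alpha> (D *\<^sub>v w) a = mat_act (length \<sigma>) (scalars \<sigma> \<rho> D) (component \<sigma> \<alpha> w) a"
  proof (cases "a < length \<rho>")
    case False
    then show ?thesis by (simp add: component_def mat_act_def scalars_def)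
  next
    case True
    have "(D *\<^sub>v w) $ a = (\<Sum>b<length \<sigma>. D $$ (a, b) * w $ b)"
      using True car w by (simp add: scalar_prod_def lessThan_atLeast0)
    then have "component \<rho> \<alpha> (D *\<^sub>v w) a = (\<Sum>b<length \<sigma>. hcoeff (\<lambda>x. \<alpha> x - (\<rho> ! a) x) (D $$ (a, b) * w $ b))"
      using True by (simp add: component_def hcoeff_sum)
    also have "\<dots> = (\<Sum>b<length \<sigma>. scalars \<sigma> \<rho> D a b * component \<sigma> \<alpha> w b)"
    proof (rule sum.cong)
      fix b assume b: "b \<in> {..<length \<sigma>}"
      then have "homogeneous (\<lambda>x. (\<sigma> ! b) x - (\<rho> ! a) x) (D $$ (a, b))"
        using D True by (simp add: graded_map_def)
      from hcoeff_homogeneous_times[OF this]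
      show "hcoeff (\<lambda>x. \<alpha> x - (\<rho> ! a) x) (D $$ (a, b) * w $ b) = scalars \<sigma> \<rho> D a b * component \<sigma> \<alpha> w b"
        using b True by (simp add: scalars_def component_def)
    qed simp
    finally show ?thesis by (simp add: mat_act_def)
  qed
qed

lemma mult_to_vec:
  assumes D: "graded_map \<sigma> \<rho> D" and c: "c \<in> strand \<sigma> \<alpha>"
  shows "component \<rho> \<beta> (D *\<^sub>v to_vec \<sigma> \<alpha> c) = (if \<beta> = \<alpha> then mat_act (length \<sigma>) (scalars \<sigma> \<rho> D) c else (\<lambda>_. 0))"
  using component_to_vec[OF c] by (simp add: component_mult[OF D])

lemma finite_components:
  fixes w :: "('v::finite, 'k::field) mpoly vec"
  shows "finite {\<alpha>. component \<sigma> \<alpha> w \<noteq> (\<lambda>_. 0)}"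
proof (rule finite_subset)
  show "{\<alpha>. component \<sigma> \<alpha> w \<noteq> (\<lambda>_. 0)} \<subseteq>
      (\<Union>b<length \<sigma>. (\<lambda>m x. degree_of m x + (\<sigma> ! b) x) ` Poly_Mapping.keys (w $ b))"
  proof
    fix \<alpha> assume "\<alpha> \<in> {\<alpha>. component \<sigma> \<alpha> w \<noteq> (\<lambda>_. 0)}"
    then obtain b where "component \<sigma> \<alpha> w b \<noteq> 0" by auto
    then have b: "b < length \<sigma>" "hcoeff (\<lambda>x. \<alpha> x - (\<sigma> ! b) x) (w $ b) \<noteq> 0" by (auto simp: component_def split: if_splits)
    let ?m = "exponent (\<lambda>x. \<alpha> x - (\<sigma> ! b) x)"
    have nn: "(\<lambda>_. 0) \<le> (\<lambda>x. \<alpha> x - (\<sigma> ! b) x)" and "?m \<in> Poly_Mapping.keys (w $ b)"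
      using b(2) by (auto simp: hcoeff_def in_keys_iff split: if_splits)
    moreover have "\<alpha> = (\<lambda>x. degree_of ?m x + (\<sigma> ! b) x)" using degree_of_exponent[OF nn] by auto
    ultimately show "\<alpha> \<in> (\<Union>b<length \<sigma>. (\<lambda>m x. degree_of m x + (\<sigma> ! b) x) ` Poly_Mapping.keys (w $ b))"
      using b(1) by blast
  qed
qed simp

text \<open>A vector over the polynomial ring lies in the image as soon as each of its homogeneous
  components does, since it has only finitely many of them.\<close>

lemma image_componentwise:
  fixes w :: "('v::finite, 'k::field) mpoly vec"
  assumes D: "graded_map \<sigma> \<rho> D" and w: "w \<in> carrier_vec (length \<rho>)"
    and lift: "\<And>\<alpha>. \<exists>e\<in>strand \<sigma> \<alpha>. mat_act (length \<sigma>) (scalars \<sigma> \<rho> D) e = component \<rho> \<alpha> w"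
  shows "\<exists>u\<in>carrier_vec (length \<sigma>). D *\<^sub>v u = w"
proof -
  obtain e where e: "\<And>\<alpha>. e \<alpha> \<in> strand \<sigma> \<alpha>"
    "\<And>\<alpha>. mat_act (length \<sigma>) (scalars \<sigma> \<rho> D) (e \<alpha>) = component \<rho> \<alpha> w"
    using lift by metis
  define S where "S = {\<alpha>. component \<rho> \<alpha> w \<noteq> (\<lambda>_. 0)}"
  have fin: "finite S" unfolding S_def by (rule finite_components)
  define u where "u = vec (length \<sigma>) (\<lambda>b. \<Sum>\<alpha>\<in>S. to_vec \<sigma> \<alpha> (e \<alpha>) $ b)"
  have u: "u \<in> carrier_vec (length \<sigma>)" by (simp add: u_def)
  have cu: "component \<sigma> \<beta> u = (if \<beta> \<in> S then e \<beta> else (\<lambda>_. 0))" for \<beta>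
  proof
    fix b
    have "component \<sigma> \<beta> u b = (\<Sum>\<alpha>\<in>S. component \<sigma> \<beta> (to_vec \<sigma> \<alpha> (e \<alpha>)) b)"
      by (simp add: component_def u_def hcoeff_sum)
    also have "\<dots> = (\<Sum>\<alpha>\<in>S. if \<alpha> = \<beta> then e \<beta> b else 0)"
      by (intro sum.cong) (auto simp: component_to_vec[OF e(1)])
    finally show "component \<sigma> \<beta> u b = (if \<beta> \<in> S then e \<beta> else (\<lambda>_. 0)) b"
      using fin by (simp add: sum.delta)
  qed
  have "D *\<^sub>v u = w"
  proof (rule component_eqI)
    show "D *\<^sub>v u \<in> carrier_vec (length \<rho>)"
      by (rule mult_mat_vec_carrier[OF _ u]) (use D in \<open>simp add: graded_map_def\<close>)
    show "component \<rho> \<alpha> (D *\<^sub>v u) = component \<rho> \<alpha> w" for \<alpha>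
      using e(2)[of \<alpha>] by (cases "\<alpha> \<in> S") (simp_all add: component_mult[OF D u] cu S_def)
  qed (rule w)
  with u show ?thesis by blast
qed

section \<open>Membership in monomial ideals\<close>

lemma module_mult: "Modules.module ((*) :: 'a::comm_ring_1 \<Rightarrow> 'a \<Rightarrow> 'a)"
  by unfold_locales (auto simp: algebra_simps)

lemma ideal_generated_monomials:
  fixes M :: "('v \<Rightarrow>\<^sub>0 nat) set"
  shows "p \<in> ideal_generated ((\<lambda>m. Poly_Mapping.single m (1 :: 'k::field)) ` M) \<longleftrightarrow>
    (\<forall>k\<in>Poly_Mapping.keys p. \<exists>m\<in>M. \<exists>k'. k = m + k')"
proof
  interpret module "(*) :: ('v, 'k) mpoly \<Rightarrow> ('v, 'k) mpoly \<Rightarrow> ('v, 'k) mpoly" by (rule module_mult)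
  let ?B = "(\<lambda>m. Poly_Mapping.single m (1 :: 'k)) ` M"
  assume "p \<in> ideal_generated ?B"
  then have "p \<in> span ?B" by (simp add: ideal_generated_def)
  then show "\<forall>k\<in>Poly_Mapping.keys p. \<exists>m\<in>M. \<exists>k'. k = m + k'"
  proof (induction rule: span_induct_alt)
    case base
    then show ?case by simp
  next
    case (step c x y)
    obtain m where m: "m \<in> M" "x = Poly_Mapping.single m 1" using step by blast
    show ?case
    proof
      fix k assume "k \<in> Poly_Mapping.keys (c * x + y)"
      then have "k \<in> Poly_Mapping.keys (c * x) \<or> k \<in> Poly_Mapping.keys y"
        using Poly_Mapping.keys_add[of "c * x" y] by blast
      then show "\<exists>m\<in>M. \<exists>k'. k = m + k'"
      proof
        assume "k \<in> Poly_Mapping.keys (c * x)"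
        then obtain a where "k = a + m" using keys_mult[of c x] m(2) by (auto split: if_splits)
        then show ?thesis using m(1) by (metis add.commute)
      qed (use step in blast)
    qed
  qed
next
  interpret module "(*) :: ('v, 'k) mpoly \<Rightarrow> ('v, 'k) mpoly \<Rightarrow> ('v, 'k) mpoly" by (rule module_mult)
  let ?B = "(\<lambda>m. Poly_Mapping.single m (1 :: 'k)) ` M"
  assume *: "\<forall>k\<in>Poly_Mapping.keys p. \<exists>m\<in>M. \<exists>k'. k = m + k'"
  have "Poly_Mapping.single k (Poly_Mapping.lookup p k) \<in> span ?B" if k: "k \<in> Poly_Mapping.keys p" for k
  proof -
    obtain m k' where m: "m \<in> M" "k = m + k'" using * k by blast
    have "Poly_Mapping.single k' (Poly_Mapping.lookup p k) * Poly_Mapping.single m 1 \<in> span ?B"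
      using m(1) by (intro span_scale span_base) blast
    then show ?thesis using m(2) by (simp add: mult_single add.commute)
  qed
  then have "(\<Sum>k\<in>Poly_Mapping.keys p. Poly_Mapping.single k (Poly_Mapping.lookup p k)) \<in> span ?B"
    by (rule span_sum)
  then show "p \<in> ideal_generated ?B"
    unfolding ideal_generated_def poly_mapping_eq_sum_single[symmetric] .
qed

text \<open>Makes minimality visible in scalars: an entry joining two generators of equal degree
  must be 0.\<close>

lemma mem_ideal_of_variables:
  fixes p :: "('v::finite, 'k::field) mpoly"
  shows "p \<in> ideal_generated (range var) \<longleftrightarrow> hcoeff (\<lambda>_. 0) p = 0"
proof -
  have "range var = (\<lambda>m. Poly_Mapping.single m (1 :: 'k)) ` range (\<lambda>x::'v. Poly_Mapping.single x 1)"
    by (auto simp: var_def)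
  then have "p \<in> ideal_generated (range var) \<longleftrightarrow>
      (\<forall>k\<in>Poly_Mapping.keys p. \<exists>x k'. k = Poly_Mapping.single x 1 + k')"
    by (simp add: ideal_generated_monomials)
  also have "\<dots> \<longleftrightarrow> (\<forall>k\<in>Poly_Mapping.keys p. k \<noteq> 0)"
  proof (rule ball_cong)
    fix k :: "'v \<Rightarrow>\<^sub>0 nat"
    show "(\<exists>x k'. k = Poly_Mapping.single x 1 + k') \<longleftrightarrow> k \<noteq> 0"
    proof
      assume "\<exists>x k'. k = Poly_Mapping.single x 1 + k'"
      then obtain x k' where "k = Poly_Mapping.single x 1 + k'" by blast
      then have "Poly_Mapping.lookup k x \<noteq> 0" by (simp add: lookup_add)
      then show "k \<noteq> 0" by auto
    next
      assume "k \<noteq> 0"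
      then obtain x where "Poly_Mapping.lookup k x \<noteq> 0" by (metis poly_mapping_eqI lookup_zero)
      then have "k = Poly_Mapping.single x 1 + (k - Poly_Mapping.single x 1)"
        by (intro poly_mapping_eqI) (auto simp: lookup_add lookup_minus lookup_single when_def)
      then show "\<exists>x k'. k = Poly_Mapping.single x 1 + k'" by blast
    qed
  qed simp
  also have "\<dots> \<longleftrightarrow> Poly_Mapping.lookup p 0 = 0" by (auto simp: in_keys_iff)
  also have "\<dots> \<longleftrightarrow> hcoeff (\<lambda>_. 0) p = 0"
  proof -
    have "exponent (\<lambda>_::'v. 0) = 0" by (rule poly_mapping_eqI) (simp add: lookup_exponent)
    then show ?thesis by (simp add: hcoeff_def)
  qed
  finally show ?thesis .
qed

lemma mem_edge_ideal:
  fixes p :: "('v::finite, 'k::field) mpoly"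
  assumes "loopless G"
  shows "p \<in> edge_ideal G \<longleftrightarrow> (\<forall>\<alpha>. hcoeff \<alpha> p \<noteq> 0 \<longrightarrow> edge_degree G \<alpha>)"
proof -
  let ?M = "{Poly_Mapping.single x 1 + Poly_Mapping.single y 1 | x y. {x, y} \<in> edges G} :: ('v \<Rightarrow>\<^sub>0 nat) set"
  have "{var x * var y | x y. {x, y} \<in> edges G} = (\<lambda>m. Poly_Mapping.single m (1 :: 'k)) ` ?M"
    by (force simp: var_def mult_single)
  then have "p \<in> edge_ideal G \<longleftrightarrow> (\<forall>k\<in>Poly_Mapping.keys p. \<exists>m\<in>?M. \<exists>k'. k = m + k')"
    by (simp only: edge_ideal_def ideal_generated_monomials)
  also have "\<dots> \<longleftrightarrow> (\<forall>k\<in>Poly_Mapping.keys p. edge_degree G (degree_of k))"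
  proof (rule ball_cong)
    fix k :: "'v \<Rightarrow>\<^sub>0 nat"
    show "(\<exists>m\<in>?M. \<exists>k'. k = m + k') \<longleftrightarrow> edge_degree G (degree_of k)"
    proof
      assume "\<exists>m\<in>?M. \<exists>k'. k = m + k'"
      then obtain x y k' where "{x, y} \<in> edges G" "k = Poly_Mapping.single x 1 + Poly_Mapping.single y 1 + k'"
        by blast
      then show "edge_degree G (degree_of k)"
        by (intro edge_degreeI[of x y]) (auto simp: degree_of_def lookup_add)
    next
      assume "edge_degree G (degree_of k)"
      then obtain x y where xy: "{x, y} \<in> edges G" "1 \<le> Poly_Mapping.lookup k x" "1 \<le> Poly_Mapping.lookup k y"
        by (auto simp: edge_degree_def degree_of_def)
      let ?m = "Poly_Mapping.single x 1 + Poly_Mapping.single y 1 :: 'v \<Rightarrow>\<^sub>0 nat"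
      \<comment> \<open>Without loops \<open>?m\<close> is squarefree, so exponents at least 1 at
        both endpoints give divisibility.\<close>
      have "x \<noteq> y" using assms xy(1) by (auto simp: loopless_def)
      with xy have "k = ?m + (k - ?m)"
        by (intro poly_mapping_eqI) (auto simp: lookup_add lookup_minus lookup_single when_def)
      moreover have "?m \<in> ?M" using xy(1) by blast
      ultimately show "\<exists>m\<in>?M. \<exists>k'. k = m + k'" by blast
    qed
  qed simp
  also have "\<dots> \<longleftrightarrow> (\<forall>\<alpha>. hcoeff \<alpha> p \<noteq> 0 \<longrightarrow> edge_degree G \<alpha>)"
  proof
    assume *: "\<forall>k\<in>Poly_Mapping.keys p. edge_degree G (degree_of k)"
    show "\<forall>\<alpha>. hcoeff \<alpha> p \<noteq> 0 \<longrightarrow> edge_degree G \<alpha>"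
    proof (intro allI impI)
      fix \<alpha> assume "hcoeff \<alpha> p \<noteq> 0"
      then have nn: "(\<lambda>_. 0) \<le> \<alpha>" and "exponent \<alpha> \<in> Poly_Mapping.keys p" by (auto simp: hcoeff_def in_keys_iff split: if_splits)
      with * have "edge_degree G (degree_of (exponent \<alpha>))" by blast
      then show "edge_degree G \<alpha>" by (simp add: degree_of_exponent[OF nn])
    qed
  next
    assume "\<forall>\<alpha>. hcoeff \<alpha> p \<noteq> 0 \<longrightarrow> edge_degree G \<alpha>"
    then show "\<forall>k\<in>Poly_Mapping.keys p. edge_degree G (degree_of k)" by (simp add: hcoeff_degree_of in_keys_iff)
  qed
  finally show ?thesis .
qed

section \<open>Passage between minimal free resolutions and strand resolutions\<close>

lemma edge_degree_nonneg: "edge_degree G \<alpha> \<Longrightarrow> (\<lambda>_. 0) \<le> \<alpha>"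
  by (simp add: edge_degree_def le_fun_def)

lemma not_edge_degree_0: "\<not> edge_degree G (\<lambda>_. 0)"
  by (simp add: edge_degree_def)

text \<open>Prepending the ring turns a resolution of I into one of R/I and produces the index shift
  of \<open>strand_resolution\<close>.\<close>

definition aug_degrees :: "(nat \<Rightarrow> ('v \<Rightarrow> int) list) \<Rightarrow> nat \<Rightarrow> ('v \<Rightarrow> int) list" where
  "aug_degrees F i = (case i of 0 \<Rightarrow> [\<lambda>_. 0] | Suc j \<Rightarrow> F j)"

lemma aug_degrees_simps [simp]: "aug_degrees F 0 = [\<lambda>_. 0]" "aug_degrees F (Suc i) = F i"
  by (auto simp: aug_degrees_def)

lemma mult_carrier:
  "graded_map \<sigma> \<rho> D \<Longrightarrow> v \<in> carrier_vec (length \<sigma>) \<Longrightarrow> D *\<^sub>v v \<in> carrier_vec (length \<rho>)"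
  by (rule mult_mat_vec_carrier) (simp_all add: graded_map_def)

lemma mat_kernel_graded:
  assumes "graded_map \<sigma> \<rho> D"
  shows "mat_kernel D = {v \<in> carrier_vec (length \<sigma>). D *\<^sub>v v = 0\<^sub>v (length \<rho>)}"
  using assms by (auto simp: graded_map_def mat_kernel_def)

lemma hcoeff_augmentation:
  fixes v :: "('v::finite, 'k::field) mpoly vec"
  assumes "graded_map \<sigma> [\<lambda>_. 0] D" "v \<in> carrier_vec (length \<sigma>)"
  shows "hcoeff \<alpha> ((D *\<^sub>v v) $ 0) = mat_act (length \<sigma>) (scalars \<sigma> [\<lambda>_. 0] D) (component \<sigma> \<alpha> v) 0"
  using fun_cong[OF component_mult[OF assms, of \<alpha>], of 0] by (simp add: component_def)

text \<open>The given minimality speaks of the maps \<open>d (Suc i)\<close>. For the augmentation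
  the strict inequality of degrees comes from 1 not being in the ideal.\<close>

lemma strand_resolution_of_minimal:
  fixes d :: "nat \<Rightarrow> ('v::finite, 'k::field) mpoly mat"
  assumes G: "loopless G" and res: "minimal_free_resolution (edge_ideal G) F d"
  shows "strand_resolution (edge_degree G) (aug_degrees F)
    (\<lambda>i. scalars (aug_degrees F (Suc i)) (aug_degrees F i) (d i))"
proof -
  let ?F = "aug_degrees F"
  define L where "L i = scalars (?F (Suc i)) (?F i) (d i)" for i
  have gm: "graded_map (?F (Suc i)) (?F i) (d i)" for i
    using res by (cases i) (auto simp: minimal_free_resolution_def)
  have gm0: "graded_map (F 0) [\<lambda>_. 0] (d 0)" using gm[of 0] by simp
  have img: "{(d 0 *\<^sub>v v) $ 0 | v. v \<in> carrier_vec (length (F 0))} = edge_ideal G"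
    and ker: "\<And>i. mat_kernel (d i) = {d (Suc i) *\<^sub>v w | w. w \<in> carrier_vec (length (F (Suc i)))}"
    and min: "\<And>i. elements_mat (d (Suc i)) \<subseteq> ideal_generated (range var)"
    using res by (auto simp: minimal_free_resolution_def)
  have aug0: "edge_degree G \<alpha>" if e: "e \<in> strand (F 0) \<alpha>" "mat_act (length (F 0)) (L 0) e 0 \<noteq> 0" for e \<alpha>
  proof -
    have "(d 0 *\<^sub>v to_vec (F 0) \<alpha> e) $ 0 \<in> edge_ideal G" using img to_vec_carrier by blast
    moreover have "hcoeff \<alpha> ((d 0 *\<^sub>v to_vec (F 0) \<alpha> e) $ 0) = mat_act (length (F 0)) (L 0) e 0"
      using hcoeff_augmentation[OF gm0 to_vec_carrier] component_to_vec[OF e(1)] by (simp add: L_def)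
    ultimately show ?thesis using mem_edge_ideal[OF G] e(2) by metis
  qed
  have "strand_resolution (edge_degree G) ?F L"
  proof
    show "?F 0 = [\<lambda>_. 0]" by simp
  next
    fix i a b assume nz: "L i a b \<noteq> 0"
    then have ab: "a < length (?F i)" "b < length (?F (Suc i))"
      and hcoeff: "hcoeff (\<lambda>x. (?F (Suc i) ! b) x - (?F i ! a) x) (d i $$ (a, b)) \<noteq> 0"
      by (auto simp: L_def scalars_def split: if_splits)
    have le: "?F i ! a \<le> ?F (Suc i) ! b" using hcoeff by (auto simp: hcoeff_def le_fun_def split: if_splits)
    have "?F i ! a \<noteq> ?F (Suc i) ! b"
    proof
      assume eq: "?F i ! a = ?F (Suc i) ! b"
      show False
      proof (cases i)
        case 0
        have b: "b < length (F 0)" "a = 0" "F 0 ! b = (\<lambda>_. 0)" using ab eq 0 by auto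
        have "std_unit b \<in> strand (F 0) (\<lambda>_. 0)" using b by (intro std_unit_strand) auto
        moreover have "mat_act (length (F 0)) (L 0) (std_unit b) 0 \<noteq> 0"
          using nz 0 b mat_act_unit[of b "length (F 0)" "L 0" 0] by simp
        ultimately show False using aug0 not_edge_degree_0 by blast
      next
        case (Suc j)
        have "d i \<in> carrier_mat (length (?F i)) (length (?F (Suc i)))" using gm by (simp add: graded_map_def)
        then have "d i $$ (a, b) \<in> elements_mat (d i)" using ab by auto
        then have "hcoeff (\<lambda>_. 0) (d i $$ (a, b)) = 0" using min[of j] Suc mem_ideal_of_variables by blast
        with hcoeff eq show False by simp
      qed
    qed
    with ab le show "a < length (?F i) \<and> b < length (?F (Suc i)) \<and> ?F i ! a < ?F (Suc i) ! b" by simp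
  next
    fix \<alpha>
    show "edge_degree G \<alpha> \<longleftrightarrow> (\<exists>e\<in>strand (?F 1) \<alpha>. mat_act (length (?F 1)) (L 0) e = std_unit 0)"
    proof
      assume P: "edge_degree G \<alpha>"
      then have "graded_term \<alpha> 1 \<in> (edge_ideal G :: ('v, 'k) mpoly set)"
        by (auto simp: mem_edge_ideal[OF G] hcoeff_graded_term split: if_splits)
      then have "graded_term \<alpha> 1 \<in> {(d 0 *\<^sub>v v) $ 0 | v. v \<in> carrier_vec (length (F 0))}" by (simp only: img)
      then obtain v where v: "v \<in> carrier_vec (length (F 0))" "graded_term \<alpha> 1 = (d 0 *\<^sub>v v) $ 0" by blast
      have "mat_act (length (F 0)) (L 0) (component (F 0) \<alpha> v) = component [\<lambda>_. 0] \<alpha> (d 0 *\<^sub>v v)"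
        using component_mult[OF gm0 v(1)] by (simp add: L_def)
      also have "\<dots> = std_unit 0"
        using v(2)[symmetric] edge_degree_nonneg[OF P] by (auto simp: component_def std_unit_def hcoeff_graded_term fun_eq_iff)
      finally have "mat_act (length (F 0)) (L 0) (component (F 0) \<alpha> v) = std_unit 0" .
      then show "\<exists>e\<in>strand (?F 1) \<alpha>. mat_act (length (?F 1)) (L 0) e = std_unit 0"
        using component_strand[of "F 0" \<alpha> v] by (intro bexI[of _ "component (F 0) \<alpha> v"]) simp_all
    next
      assume "\<exists>e\<in>strand (?F 1) \<alpha>. mat_act (length (?F 1)) (L 0) e = std_unit 0"
      then obtain e where "e \<in> strand (F 0) \<alpha>" "mat_act (length (F 0)) (L 0) e = std_unit 0" by auto
      then show "edge_degree G \<alpha>" using aug0[of e \<alpha>] by (simp add: std_unit_def)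
    qed
  next
    fix i \<alpha> and c :: "nat \<Rightarrow> 'k" assume c: "c \<in> strand (?F (Suc i)) \<alpha>"
    have ker': "mat_kernel (d i) = {v \<in> carrier_vec (length (F i)). d i *\<^sub>v v = 0\<^sub>v (length (?F i))}"
      using mat_kernel_graded[OF gm[of i]] by simp
    have gi: "graded_map (F i) (?F i) (d i)" and gs: "graded_map (F (Suc i)) (F i) (d (Suc i))"
      using gm[of i] gm[of "Suc i"] by auto
    have Li: "L i = scalars (F i) (?F i) (d i)" "L (Suc i) = scalars (F (Suc i)) (F i) (d (Suc i))"
      by (auto simp: L_def)
    have c': "c \<in> strand (F i) \<alpha>" using c by simp
    have "mat_act (length (F i)) (L i) c = (\<lambda>_. 0) \<longleftrightarrow>
      (\<exists>e\<in>strand (F (Suc i)) \<alpha>. mat_act (length (F (Suc i))) (L (Suc i)) e = c)"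
    proof
      assume z: "mat_act (length (F i)) (L i) c = (\<lambda>_. 0)"
      have "d i *\<^sub>v to_vec (F i) \<alpha> c = 0\<^sub>v (length (?F i))"
      proof (rule component_eqI)
        show "d i *\<^sub>v to_vec (F i) \<alpha> c \<in> carrier_vec (length (?F i))" by (rule mult_carrier[OF gi to_vec_carrier])
        show "component (?F i) \<beta> (d i *\<^sub>v to_vec (F i) \<alpha> c) = component (?F i) \<beta> (0\<^sub>v (length (?F i)))" for \<beta>
          using mult_to_vec[OF gi c', of \<beta>] z by (simp add: Li)
      qed simp
      then have "to_vec (F i) \<alpha> c \<in> mat_kernel (d i)" by (simp add: ker')
      then obtain w where w: "w \<in> carrier_vec (length (F (Suc i)))" "to_vec (F i) \<alpha> c = d (Suc i) *\<^sub>v w"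
        using ker by blast
      have "mat_act (length (F (Suc i))) (L (Suc i)) (component (F (Suc i)) \<alpha> w) = c"
        using component_mult[OF gs w(1), of \<alpha>] component_to_vec[OF c', of \<alpha>] w(2) by (simp add: Li)
      then show "\<exists>e\<in>strand (F (Suc i)) \<alpha>. mat_act (length (F (Suc i))) (L (Suc i)) e = c"
        using component_strand[of "F (Suc i)" \<alpha> w] by blast
    next
      assume "\<exists>e\<in>strand (F (Suc i)) \<alpha>. mat_act (length (F (Suc i))) (L (Suc i)) e = c"
      then obtain e where e: "e \<in> strand (F (Suc i)) \<alpha>" "mat_act (length (F (Suc i))) (L (Suc i)) e = c" by blast
      let ?v = "d (Suc i) *\<^sub>v to_vec (F (Suc i)) \<alpha> e"
      have "?v \<in> mat_kernel (d i)" using ker to_vec_carrier by blast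
      then have v: "?v \<in> carrier_vec (length (F i))" "d i *\<^sub>v ?v = 0\<^sub>v (length (?F i))" by (auto simp: ker')
      have "component (F i) \<alpha> ?v = c" using mult_to_vec[OF gs e(1), of \<alpha>] e(2) by (simp add: Li)
      then show "mat_act (length (F i)) (L i) c = (\<lambda>_. 0)"
        using component_mult[OF gi v(1), of \<alpha>] v(2) by (simp add: Li)
    qed
    then show "mat_act (length (?F (Suc i))) (L i) c = (\<lambda>_. 0) \<longleftrightarrow>
        (\<exists>e\<in>strand (?F (Suc (Suc i))) \<alpha>. mat_act (length (?F (Suc (Suc i)))) (L (Suc i)) e = c)"
      by simp
  qed
  then show ?thesis unfolding L_def .
qed

text \<open>Each scalar is multiplied by the monomial that its row and column degrees prescribe.
  This yields existence, without which the choice in \<open>minimal_resolution_degrees\<close> would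
  be unconstrained.\<close>

lemma minimal_of_strand_resolution:
  fixes L :: "nat \<Rightarrow> nat \<Rightarrow> nat \<Rightarrow> 'k::field" and G :: "'v::finite graph"
  assumes G: "loopless G" and res: "strand_resolution (edge_degree G) F L"
  shows "\<exists>d. minimal_free_resolution (edge_ideal G :: ('v, 'k) mpoly set) (\<lambda>i. F (Suc i)) d"
proof -
  interpret strand_resolution "edge_degree G" F L by (rule res)
  define d :: "nat \<Rightarrow> ('v, 'k) mpoly mat" where
    "d i = mat (length (F i)) (length (F (Suc i))) (\<lambda>(a, b). graded_term (\<lambda>x. (F (Suc i) ! b) x - (F i ! a) x) (L i a b))" for i
  have gm: "graded_map (F (Suc i)) (F i) (d i)" for i
    by (simp add: graded_map_def d_def homogeneous_graded_term)
  have gm0: "graded_map (F 1) [\<lambda>_. 0] (d 0)" using gm[of 0] F0 by simp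
  have sc: "scalars (F (Suc i)) (F i) (d i) = L i" for i
  proof (intro ext)
    fix a b show "scalars (F (Suc i)) (F i) (d i) a b = L i a b"
      using entry[of i a b] less_imp_le[of "F i ! a" "F (Suc i) ! b"]
      by (cases "L i a b = 0") (auto simp: scalars_def d_def hcoeff_graded_term le_fun_def)
  qed
  have app: "component (F i) \<alpha> (d i *\<^sub>v v) = bd i (component (F (Suc i)) \<alpha> v)"
    if "v \<in> carrier_vec (length (F (Suc i)))" for i \<alpha> v
    using component_mult[OF gm that] by (simp add: sc bd_def)
  have "minimal_free_resolution (edge_ideal G) (\<lambda>i. F (Suc i)) d"
    unfolding minimal_free_resolution_def
  proof (intro conjI allI)
    show "graded_map (F (Suc 0)) [\<lambda>_. 0] (d 0)" using gm0 by simp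
    show "graded_map (F (Suc (Suc i))) (F (Suc i)) (d (Suc i))" for i by (rule gm)
    show "{(d 0 *\<^sub>v v) $ 0 | v. v \<in> carrier_vec (length (F (Suc 0)))} = edge_ideal G"
    proof (intro equalityI subsetI)
      fix p assume "p \<in> {(d 0 *\<^sub>v v) $ 0 | v. v \<in> carrier_vec (length (F (Suc 0)))}"
      then obtain v where v: "v \<in> carrier_vec (length (F (Suc 0)))" "p = (d 0 *\<^sub>v v) $ 0" by blast
      have "edge_degree G \<alpha>" if nz: "hcoeff \<alpha> p \<noteq> 0" for \<alpha>
      proof -
        have "hcoeff \<alpha> p = bd 0 (component (F 1) \<alpha> v) 0"
          using fun_cong[OF app[OF v(1), of \<alpha>], of 0] v(2) by (simp add: component_def F0)
        with nz have "bd 0 (component (F 1) \<alpha> v) \<noteq> (\<lambda>_. 0)" by auto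
        then show ?thesis by (rule aug_scale[OF component_strand])
      qed
      then show "p \<in> edge_ideal G" by (simp add: mem_edge_ideal[OF G])
    next
      fix p :: "('v, 'k) mpoly" assume p: "p \<in> edge_ideal G"
      \<comment> \<open>A polynomial is read as a vector of length 1, so that
        \<open>image_componentwise\<close> applies to the augmentation.\<close>
      let ?w = "vec 1 (\<lambda>_. p)"
      have "\<exists>e\<in>strand (F 1) \<alpha>. bd 0 e = component (F 0) \<alpha> ?w" for \<alpha>
      proof (cases "edge_degree G \<alpha>")
        case True
        from aug_lift[OF this component_strand[of "F 0" \<alpha> ?w]] show ?thesis by blast
      next
        case False
        then have "hcoeff \<alpha> p = 0" using p mem_edge_ideal[OF G] by blast
        then have "component (F 0) \<alpha> ?w = (\<lambda>_. 0)" by (auto simp: component_def F0 fun_eq_iff)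
        then show ?thesis by (intro bexI[of _ "\<lambda>_. 0"]) (simp_all add: bd_def)
      qed
      then have "\<exists>u\<in>carrier_vec (length (F (Suc 0))). d 0 *\<^sub>v u = ?w"
        using image_componentwise[OF gm[of 0], of ?w] sc[of 0] by (simp add: bd_def F0)
      then obtain u where "u \<in> carrier_vec (length (F (Suc 0)))" "d 0 *\<^sub>v u = ?w" by blast
      then have "p = (d 0 *\<^sub>v u) $ 0" by simp
      then show "p \<in> {(d 0 *\<^sub>v v) $ 0 | v. v \<in> carrier_vec (length (F (Suc 0)))}"
        using \<open>u \<in> _\<close> by blast
    qed
    show "mat_kernel (d i) = {d (Suc i) *\<^sub>v w | w. w \<in> carrier_vec (length (F (Suc (Suc i))))}" for i
    proof (intro equalityI subsetI)
      fix w assume "w \<in> mat_kernel (d i)"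
      then have w: "w \<in> carrier_vec (length (F (Suc i)))" "d i *\<^sub>v w = 0\<^sub>v (length (F i))"
        by (auto simp: mat_kernel_graded[OF gm])
      have "\<exists>e\<in>strand (F (Suc (Suc i))) \<alpha>. bd (Suc i) e = component (F (Suc i)) \<alpha> w" for \<alpha>
      proof -
        have "bd i (component (F (Suc i)) \<alpha> w) = (\<lambda>_. 0)" using app[OF w(1), of \<alpha>] w(2) by simp
        from kernel_lift[OF component_strand this] show ?thesis by blast
      qed
      then have "\<exists>u\<in>carrier_vec (length (F (Suc (Suc i)))). d (Suc i) *\<^sub>v u = w"
        using image_componentwise[OF gm[of "Suc i"] w(1)] by (simp add: sc bd_def)
      then show "w \<in> {d (Suc i) *\<^sub>v w | w. w \<in> carrier_vec (length (F (Suc (Suc i))))}" by blast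
    next
      fix v assume "v \<in> {d (Suc i) *\<^sub>v w | w. w \<in> carrier_vec (length (F (Suc (Suc i))))}"
      then obtain w where w: "w \<in> carrier_vec (length (F (Suc (Suc i))))" "v = d (Suc i) *\<^sub>v w" by blast
      have v: "v \<in> carrier_vec (length (F (Suc i)))" using mult_carrier[OF gm w(1)] w(2) by simp
      have "d i *\<^sub>v v = 0\<^sub>v (length (F i))"
      proof (rule component_eqI)
        show "d i *\<^sub>v v \<in> carrier_vec (length (F i))" by (rule mult_carrier[OF gm v])
        show "component (F i) \<alpha> (d i *\<^sub>v v) = component (F i) \<alpha> (0\<^sub>v (length (F i)))" for \<alpha>
          using app[OF v, of \<alpha>] app[OF w(1), of \<alpha>] w(2) bd_bd[OF component_strand[of "F (Suc (Suc i))" \<alpha> w]] by simp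
      qed simp
      with v show "v \<in> mat_kernel (d i)" by (simp add: mat_kernel_graded[OF gm])
    qed
    show "elements_mat (d (Suc i)) \<subseteq> ideal_generated (range var)" for i
    proof
      fix p assume "p \<in> elements_mat (d (Suc i))"
      then obtain a b where ab: "a < length (F (Suc i))" "b < length (F (Suc (Suc i)))"
        and p: "p = graded_term (\<lambda>x. (F (Suc (Suc i)) ! b) x - (F (Suc i) ! a) x) (L (Suc i) a b)"
        by (auto simp: elements_mat_def d_def)
      have "L (Suc i) a b = 0" if "(\<lambda>_. 0) = (\<lambda>x. (F (Suc (Suc i)) ! b) x - (F (Suc i) ! a) x)"
      proof (rule ccontr)
        assume "L (Suc i) a b \<noteq> 0"
        from entry[OF this] have "F (Suc i) ! a \<noteq> F (Suc (Suc i)) ! b" by auto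
        moreover have "F (Suc i) ! a = F (Suc (Suc i)) ! b"
          using that by (auto simp: fun_eq_iff)
        ultimately show False by blast
      qed
      then show "p \<in> ideal_generated (range var)"
        unfolding mem_ideal_of_variables p hcoeff_graded_term by simp
    qed
  qed
  then show ?thesis by blast
qed

section \<open>Betti numbers\<close>

lemma edge_strand_resolution_exists:
  fixes G :: "'v::finite graph"
  shows "\<exists>F (L :: nat \<Rightarrow> nat \<Rightarrow> nat \<Rightarrow> 'k::field). strand_resolution (edge_degree G) F L"
proof (rule strand_resolution_exists)
  define pair where "pair x y = (\<lambda>z. if z = x \<or> z = y then 1 else 0 :: int)" for x y :: 'v
  show "edge_degree G \<beta>" if "edge_degree G \<alpha>" "\<alpha> \<le> \<beta>" for \<alpha> \<beta>
    using that unfolding edge_degree_def le_fun_def by (meson order_trans)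
  show "\<not> edge_degree G (\<lambda>_. 0)" by (rule not_edge_degree_0)
  show "finite (range (\<lambda>(x, y). pair x y))" by simp
  show "\<exists>\<gamma>\<in>range (\<lambda>(x, y). pair x y). \<gamma> \<le> \<alpha> \<and> edge_degree G \<gamma>" if P: "edge_degree G \<alpha>" for \<alpha>
  proof -
    obtain x y where xy: "{x, y} \<in> edges G" "1 \<le> \<alpha> x" "1 \<le> \<alpha> y" "\<And>z. 0 \<le> \<alpha> z"
      using P by (auto simp: edge_degree_def)
    have "pair x y \<le> \<alpha>" using xy by (auto simp: pair_def le_fun_def)
    moreover have "edge_degree G (pair x y)" by (rule edge_degreeI[OF xy(1)]) (auto simp: pair_def)
    ultimately show ?thesis by (intro bexI[of _ "pair x y"]) auto
  qed
qed (rule edge_degree_nonneg)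

text \<open>All further arguments apply to any strand resolution, hence to the one that the choice
  returns.\<close>

lemma betti_strand_resolution:
  fixes G :: "'v::finite graph"
  assumes G: "loopless G"
  shows "\<exists>F (L :: nat \<Rightarrow> nat \<Rightarrow> nat \<Rightarrow> 'k::field). strand_resolution (edge_degree G) F L \<and>
    (\<forall>i \<alpha>. betti TYPE('k) G i \<alpha> = count_list (F (Suc i)) \<alpha>)"
proof -
  obtain F\<^sub>0 and L\<^sub>0 :: "nat \<Rightarrow> nat \<Rightarrow> nat \<Rightarrow> 'k" where "strand_resolution (edge_degree G) F\<^sub>0 L\<^sub>0"
    using edge_strand_resolution_exists by blast
  from minimal_of_strand_resolution[OF G this]
  have ex: "\<exists>F d. minimal_free_resolution (edge_ideal G :: ('v, 'k) mpoly set) F d" by blast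
  define F where "F = minimal_resolution_degrees (edge_ideal G :: ('v, 'k) mpoly set)"
  have "\<exists>d. minimal_free_resolution (edge_ideal G :: ('v, 'k) mpoly set) F d"
    unfolding F_def minimal_resolution_degrees_def by (rule someI_ex[OF ex])
  then obtain d where "minimal_free_resolution (edge_ideal G :: ('v, 'k) mpoly set) F d" by blast
  from strand_resolution_of_minimal[OF G this] show ?thesis
    by (intro exI conjI) (auto simp: betti_def F_def)
qed

text \<open>Serves twice: for G = H, and for a complete H inside G with \<alpha> supported on
  W.\<close>

lemma betti_linear:
  fixes G H :: "'v::finite graph"
  assumes H: "complete_or_bipartite W H" and G: "loopless G"
    and agree: "\<And>\<gamma>. \<gamma> \<le> \<alpha> \<Longrightarrow> edge_degree G \<gamma> \<longleftrightarrow> edge_degree H \<gamma>"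
    and nz: "betti TYPE('k::field) G i \<alpha> \<noteq> 0"
  shows "total_degree \<alpha> = int i + 2"
proof -
  obtain F and L :: "nat \<Rightarrow> nat \<Rightarrow> nat \<Rightarrow> 'k" where R: "strand_resolution (edge_degree G) F L"
    and b: "\<forall>i \<alpha>. betti TYPE('k) G i \<alpha> = count_list (F (Suc i)) \<alpha>"
    using betti_strand_resolution[OF G, where 'k = 'k] by (elim exE conjE)
  interpret strand_resolution "edge_degree G" F L by (rule R)
  have mem: "\<alpha> \<in> set (F (Suc i))" using nz b by (metis count_notin)
  then obtain t where "t < length (F (Suc i))" "F (Suc i) ! t = \<alpha>" by (auto simp: in_set_conv_nth)
  with generator_total_degree[OF edge_degree_total_degree[OF G]] have "int i + 2 \<le> total_degree \<alpha>" by blast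
  moreover have "total_degree \<alpha> < int i + 3" by (rule linear_generators[OF H agree mem])
  ultimately show ?thesis by simp
qed

text \<open>A nonzero left side lies by \<open>lin\<close> on the diagonal where the comparison map
  is injective.\<close>

lemma betti_le:
  fixes G H :: "'v::finite graph"
  assumes G: "loopless G" and H: "loopless H"
    and imp: "\<And>\<gamma>. \<gamma> \<le> \<alpha> \<Longrightarrow> edge_degree H \<gamma> \<Longrightarrow> edge_degree G \<gamma>"
    and lin: "betti TYPE('k::field) H i \<alpha> \<noteq> 0 \<Longrightarrow> total_degree \<alpha> = int i + 2"
  shows "betti TYPE('k) H i \<alpha> \<le> betti TYPE('k) G i \<alpha>"
proof (cases "betti TYPE('k) H i \<alpha> = 0")
  case False
  obtain F and L :: "nat \<Rightarrow> nat \<Rightarrow> nat \<Rightarrow> 'k" where R: "strand_resolution (edge_degree H) F L"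
    and b: "\<forall>i \<alpha>. betti TYPE('k) H i \<alpha> = count_list (F (Suc i)) \<alpha>"
    using betti_strand_resolution[OF H, where 'k = 'k] by (elim exE conjE)
  obtain F' and L' :: "nat \<Rightarrow> nat \<Rightarrow> nat \<Rightarrow> 'k" where R': "strand_resolution (edge_degree G) F' L'"
    and b': "\<forall>i \<alpha>. betti TYPE('k) G i \<alpha> = count_list (F' (Suc i)) \<alpha>"
    using betti_strand_resolution[OF G, where 'k = 'k] by (elim exE conjE)
  show ?thesis unfolding b[rule_format] b'[rule_format]
    by (rule linear_strand_count_le[OF R R' edge_degree_total_degree[OF H] edge_degree_total_degree[OF G] imp lin[OF False]])
qed simp

text \<open>A generator of degree at most e_x + e_y has total degree at least 2, so its degree is
  e_x + e_y.\<close>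

lemma betti_0_edge:
  fixes G :: "'v::finite graph"
  assumes G: "loopless G" and xy: "x \<noteq> y"
  shows "betti TYPE('k::field) G 0 (\<lambda>z. if z = x \<or> z = y then 1 else 0) \<noteq> 0 \<longleftrightarrow> {x, y} \<in> edges G"
    (is "betti _ G 0 ?\<alpha> \<noteq> 0 \<longleftrightarrow> _")
proof -
  obtain F and L :: "nat \<Rightarrow> nat \<Rightarrow> nat \<Rightarrow> 'k" where R: "strand_resolution (edge_degree G) F L"
    and b: "\<forall>i \<alpha>. betti TYPE('k) G i \<alpha> = count_list (F (Suc i)) \<alpha>"
    using betti_strand_resolution[OF G, where 'k = 'k] by (elim exE conjE)
  interpret strand_resolution "edge_degree G" F L by (rule R)
  have "{z. z = x \<or> z = y} = {x, y}" by auto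
  then have sum: "total_degree ?\<alpha> = 2" using xy by (simp add: total_degree_def sum.If_cases)
  show ?thesis
  proof
    assume "betti TYPE('k) G 0 ?\<alpha> \<noteq> 0"
    then have "?\<alpha> \<in> set (F (Suc 0))" using b by (metis count_notin)
    then have "edge_degree G ?\<alpha>" using generator_P by (metis in_set_conv_nth)
    then obtain u v where uv: "{u, v} \<in> edges G" "1 \<le> ?\<alpha> u" "1 \<le> ?\<alpha> v" by (auto simp: edge_degree_def)
    then have "u \<noteq> v" using G by (auto simp: loopless_def)
    with uv show "{x, y} \<in> edges G" by (auto split: if_splits simp: insert_commute)
  next
    assume "{x, y} \<in> edges G"
    then have "edge_degree G ?\<alpha>" by (rule edge_degreeI) auto
    then obtain e where e: "e \<in> strand (F 1) ?\<alpha>" "mat_act (length (F 1)) (L 0) e = std_unit 0" using aug by blast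
    then have "mat_act (length (F 1)) (L 0) e 0 \<noteq> 0" by (simp add: std_unit_def)
    then obtain t where "e t \<noteq> 0" using mat_act_nonzero by blast
    from strandD[OF e(1) this] have t: "t < length (F (Suc 0))" "F (Suc 0) ! t \<le> ?\<alpha>" by auto
    have "2 \<le> total_degree (F (Suc 0) ! t)"
      using generator_total_degree[OF edge_degree_total_degree[OF G] t(1)] by simp
    then have "F (Suc 0) ! t = ?\<alpha>" using total_degree_le_eq[OF t(2)] sum by simp
    then have "?\<alpha> \<in> set (F (Suc 0))" using t(1) by (metis nth_mem)
    then show "betti TYPE('k) G 0 ?\<alpha> \<noteq> 0" by (simp add: b count_list_0_iff)
  qed
qed

theorem theorem1p1:
  fixes G H :: "'v::finite graph" and W :: "'v set"
  assumes "simple_graph G" and "verts G = UNIV"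
    and "H = complete_graph W \<or>
         (\<exists>X Y. X \<noteq> {} \<and> Y \<noteq> {} \<and> X \<inter> Y = {} \<and> X \<union> Y = W \<and> H = complete_bipartite_graph X Y)"
  shows "(subgraph H G \<longleftrightarrow> (\<forall>i \<alpha>. betti TYPE('k::field) H i \<alpha> \<le> betti TYPE('k) G i \<alpha>)) \<and>
         (H = complete_graph W \<and> subgraph H G \<longrightarrow>
           (\<forall>i \<alpha>. supp \<alpha> \<subseteq> W \<longrightarrow> betti TYPE('k) H i \<alpha> = betti TYPE('k) G i \<alpha>))"
proof -
  have H: "complete_or_bipartite W H" using assms(3) by (simp add: complete_or_bipartite_def)
  have lH: "loopless H" by (rule loopless_complete_or_bipartite[OF H])
  have lG: "loopless G" using assms(1) by (auto simp: simple_graph_def loopless_def subset_iff)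
  have linH: "total_degree \<alpha> = int i + 2" if "betti TYPE('k) H i \<alpha> \<noteq> 0" for i \<alpha>
    using betti_linear[OF H lH _ that] by simp
  have sub: "subgraph H G \<longleftrightarrow> edges H \<subseteq> edges G" using assms(2) by (simp add: subgraph_def)
  have le: "betti TYPE('k) H i \<alpha> \<le> betti TYPE('k) G i \<alpha>" if "edges H \<subseteq> edges G" for i \<alpha>
  proof (rule betti_le[OF lG lH])
    show "edge_degree H \<gamma> \<Longrightarrow> edge_degree G \<gamma>" for \<gamma> using that by (auto simp: edge_degree_def)
  qed (rule linH)
  have edges: "edges H \<subseteq> edges G" if le: "\<forall>i \<alpha>. betti TYPE('k) H i \<alpha> \<le> betti TYPE('k) G i \<alpha>"
  proof
    fix e assume e: "e \<in> edges H"
    have "\<exists>x y. e = {x, y}"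
      using e H by (auto simp: complete_or_bipartite_def complete_graph_def complete_bipartite_graph_def) blast+
    then obtain x y where xy: "e = {x, y}" by blast
    with e lH have "x \<noteq> y" by (auto simp: loopless_def)
    have "betti TYPE('k) H 0 (\<lambda>z. if z = x \<or> z = y then 1 else 0) \<noteq> 0"
      using betti_0_edge[OF lH \<open>x \<noteq> y\<close>] e xy by blast
    then have "betti TYPE('k) G 0 (\<lambda>z. if z = x \<or> z = y then 1 else 0) \<noteq> 0"
      using le by (metis le_zero_eq)
    then show "e \<in> edges G" using betti_0_edge[OF lG \<open>x \<noteq> y\<close>] xy by blast
  qed
  have eq: "betti TYPE('k) H i \<alpha> = betti TYPE('k) G i \<alpha>"
    if K: "H = complete_graph W" and HG: "edges H \<subseteq> edges G" and \<alpha>: "supp \<alpha> \<subseteq> W" for i \<alpha>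
  proof (rule antisym)
    show "betti TYPE('k) H i \<alpha> \<le> betti TYPE('k) G i \<alpha>" by (rule le[OF HG])
    \<comment> \<open>An edge of G whose monomial divides x^\<alpha> has both endpoints in W, and
      the complete H contains every edge inside W.\<close>
    have agree: "edge_degree G \<gamma> \<longleftrightarrow> edge_degree H \<gamma>" if g: "\<gamma> \<le> \<alpha>" for \<gamma>
    proof
      assume "edge_degree H \<gamma>"
      then show "edge_degree G \<gamma>" using HG by (auto simp: edge_degree_def)
    next
      assume P: "edge_degree G \<gamma>"
      then obtain x y where xy: "{x, y} \<in> edges G" "1 \<le> \<gamma> x" "1 \<le> \<gamma> y" "\<And>z. 0 \<le> \<gamma> z"
        by (auto simp: edge_degree_def)
      have W: "z \<in> W" if "1 \<le> \<gamma> z" for z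
      proof -
        have "1 \<le> \<alpha> z" using that g order_trans by (auto simp: le_fun_def)
        then show ?thesis using \<alpha> by (auto simp: supp_def)
      qed
      have "x \<noteq> y" using xy(1) lG by (auto simp: loopless_def)
      then have "{x, y} \<in> edges H" using W xy unfolding K complete_graph_def by auto
      then show "edge_degree H \<gamma>" by (rule edge_degreeI) (use xy in auto)
    qed
    \<comment> \<open>The comparison with roles exchanged: since the ideals agree below \<alpha>, a
      nonzero Betti number of G in degree \<alpha> lies on the linear diagonal as well.\<close>
    show "betti TYPE('k) G i \<alpha> \<le> betti TYPE('k) H i \<alpha>"
      by (rule betti_le[OF lH lG]) (use agree betti_linear[OF H lG agree] in blast)+
  qed
  show ?thesis unfolding sub using le edges eq by blast
qed

end
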